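(* Let $\mathbb{F}$ be a field with $\operatorname{char}(\mathbb{F})\neq 2$. Then $\mathbf{VNP}_1=\mathbf{VNP}$ over $\mathbb{F}$. Equivalently, a family $(f_n)$ is in $\mathbf{VNP}$ if and only if there are polynomially bounded $p(n),q(n)$ such that $f_n(\mathbf{x})=\sum_{\mathbf{b}\in\{0,1\}^{p(n)}}\prod_{i=1}^{q(n)}\ell_{n,i}(\mathbf{b},\mathbf{x})$ for affine linear forms $\ell_{n,i}$ over $\mathbb{F}$ in the variables $\mathbf{b},\mathbf{x}$, with the number of variables polynomially bounded.
   Context: A family is a sequence $(f_n)$ of polynomials; a class is a set of families. $\mathbf{VP}_1$ is the class of families (in polynomially many variables) computable by polynomial-size width-1 algebraic branching programs whose edges are labelled by arbitrary affine linear forms over $\mathbb{F}$, i.e. families where $f_n$ is a product of polynomially many affine linear forms. For a class $\mathbf{C}$, $\mathrm{N}(\mathbf{C})$ consists of the families $(f_n)$ for which there are $(g_n)\in\mathbf{C}$ and polynomially bounded $p,q$ with $f_n(\mathbf{x})=\sum_{\mathbf{b}\in\{0,1\}^{p(n)}}g_{q(n)}(\mathbf{b},\mathbf{x})$. $\mathbf{VNP}_1=\mathrm{N}(\mathbf{VP}_1)$. $\mathbf{VNP}$ is Valiant's class of p-definable families, equal to $\mathrm{N}(\mathbf{VP}_e)$, where $\mathbf{VP}_e$ is the class of families with polynomially bounded arithmetic formula size. *)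

theory Defs
  imports
    Complex_Main
    "HOL-Library.Poly_Mapping"
    "HOL-Library.FuncSet"
    "HOL-Computational_Algebra.Polynomial"
begin

section \<open>Multivariate polynomials\<close>

text \<open>Finitely supported maps from monomials to coefficients, where a monomial is a finitely
  supported map from variable indices to exponents. The ring operations are those of
  \<open>Poly_Mapping\<close>.\<close>

type_synonym 'a mpoly = "(nat \<Rightarrow>\<^sub>0 nat) \<Rightarrow>\<^sub>0 'a"

definition Const :: "'a::zero \<Rightarrow> 'a mpoly" where
  "Const c = Poly_Mapping.single 0 c"

definition Var :: "nat \<Rightarrow> 'a::zero_neq_one mpoly" where
  "Var i = Poly_Mapping.single (Poly_Mapping.single i 1) 1"

definition vars :: "'a::zero mpoly \<Rightarrow> nat set" where
  "vars f = (\<Union>m\<in>Poly_Mapping.keys f. Poly_Mapping.keys m)"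

definition monom_degree :: "(nat \<Rightarrow>\<^sub>0 nat) \<Rightarrow> nat" where
  "monom_degree m = (\<Sum>i\<in>Poly_Mapping.keys m. Poly_Mapping.lookup m i)"

text \<open>The zero polynomial has total degree 0.\<close>

definition total_degree :: "'a::zero mpoly \<Rightarrow> nat" where
  "total_degree f = Max (insert 0 (monom_degree ` Poly_Mapping.keys f))"

definition subst :: "(nat \<Rightarrow> 'a mpoly) \<Rightarrow> 'a::comm_ring_1 mpoly \<Rightarrow> 'a mpoly" where
  "subst \<sigma> f = (\<Sum>m\<in>Poly_Mapping.keys f. Const (Poly_Mapping.lookup f m) *
     (\<Prod>i\<in>Poly_Mapping.keys m. \<sigma> i ^ Poly_Mapping.lookup m i))"

definition affine_form :: "'a::comm_ring_1 mpoly \<Rightarrow> bool" where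
  "affine_form l \<longleftrightarrow> (\<exists>c a V. finite V \<and> l = Const c + (\<Sum>i\<in>V. Const (a i) * Var i))"


section \<open>Families\<close>

type_synonym 'a family = "nat \<Rightarrow> 'a mpoly"

definition poly_bounded :: "(nat \<Rightarrow> nat) \<Rightarrow> bool" where
  "poly_bounded t \<longleftrightarrow> (\<exists>P :: nat poly. \<forall>n. t n \<le> poly P n)"

text \<open>All families share the variable names \<open>Var 0, Var 1, \<dots>\<close>; only the number of variables
  occurring in the \<open>n\<close>-th polynomial is restricted, not their names.\<close>

definition poly_many_vars :: "'a::zero family \<Rightarrow> bool" where
  "poly_many_vars f \<longleftrightarrow> poly_bounded (\<lambda>n. card (vars (f n)))"


section \<open>Algebraic branching programs\<close>

text \<open>A layered branching program with layers \<open>0, \<dots>, L\<close>: layer \<open>i\<close> has the vertices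
  \<open>0, \<dots>, w i - 1\<close>, the first layer consists of the source and the last one of the sink.
  \<open>A i u v\<close> labels the edge from vertex \<open>u\<close> of layer \<open>i\<close> to vertex \<open>v\<close> of layer \<open>i + 1\<close>;
  an absent edge is represented by the label 0, which does not change the value.\<close>

definition is_abp :: "nat \<Rightarrow> (nat \<Rightarrow> nat) \<Rightarrow> (nat \<Rightarrow> nat \<Rightarrow> nat \<Rightarrow> 'a::comm_ring_1 mpoly) \<Rightarrow> bool"
  where
  "is_abp L w A \<longleftrightarrow> w 0 = 1 \<and> w L = 1 \<and> (\<forall>i\<le>L. 0 < w i) \<and>
     (\<forall>i<L. \<forall>u<w i. \<forall>v<w (Suc i). affine_form (A i u v))"

definition abp_size :: "nat \<Rightarrow> (nat \<Rightarrow> nat) \<Rightarrow> nat" where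
  "abp_size L w = (\<Sum>i\<le>L. w i)"

text \<open>The sum over all source-sink paths \<open>\<pi>\<close> of the product of the edge labels.\<close>

definition abp_value ::
  "nat \<Rightarrow> (nat \<Rightarrow> nat) \<Rightarrow> (nat \<Rightarrow> nat \<Rightarrow> nat \<Rightarrow> 'a::comm_ring_1 mpoly) \<Rightarrow> 'a mpoly" where
  "abp_value L w A =
     (\<Sum>\<pi>\<in>(\<Pi>\<^sub>E i\<in>{..L}. {..<w i}). \<Prod>i<L. A i (\<pi> i) (\<pi> (Suc i)))"

definition VP_width :: "nat \<Rightarrow> 'a::comm_ring_1 family set" where
  "VP_width k = {f. poly_many_vars f \<and>
     (\<exists>L w A. poly_bounded (\<lambda>n. abp_size (L n) (w n)) \<and>
        (\<forall>n. is_abp (L n) (w n) (A n) \<and> (\<forall>i\<le>L n. w n i \<le> k) \<and>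
             f n = abp_value (L n) (w n) (A n)))}"

abbreviation VP1 :: "'a::comm_ring_1 family set" where
  "VP1 \<equiv> VP_width 1"


section \<open>Arithmetic circuits\<close>

text \<open>Circuits of fan-in two as straight-line programs: the arguments of \<open>Add\<close> and \<open>Mult\<close>
  are positions of earlier gates, and the last gate is the output.\<close>

datatype 'a gate = Input nat | Scalar 'a | Add nat nat | Mult nat nat

fun gate_ok :: "nat \<Rightarrow> 'a gate \<Rightarrow> bool" where
  "gate_ok k (Add i j) \<longleftrightarrow> i < k \<and> j < k"
| "gate_ok k (Mult i j) \<longleftrightarrow> i < k \<and> j < k"
| "gate_ok k _ \<longleftrightarrow> True"

definition is_circuit :: "'a gate list \<Rightarrow> bool" where
  "is_circuit C \<longleftrightarrow> C \<noteq> [] \<and> (\<forall>k<length C. gate_ok k (C ! k))"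

fun gate_value :: "'a::comm_ring_1 mpoly list \<Rightarrow> 'a gate \<Rightarrow> 'a mpoly" where
  "gate_value vs (Input i) = Var i"
| "gate_value vs (Scalar c) = Const c"
| "gate_value vs (Add i j) = vs ! i + vs ! j"
| "gate_value vs (Mult i j) = vs ! i * vs ! j"

definition gate_values :: "'a::comm_ring_1 gate list \<Rightarrow> 'a mpoly list" where
  "gate_values C = foldl (\<lambda>vs g. vs @ [gate_value vs g]) [] C"

definition circuit_value :: "'a::comm_ring_1 gate list \<Rightarrow> 'a mpoly" where
  "circuit_value C = last (gate_values C)"

text \<open>Valiant's class of p-computable families: polynomially many variables, polynomially
  bounded degree and polynomially bounded circuit size.\<close>

definition VP :: "'a::comm_ring_1 family set" where
  "VP = {f. poly_many_vars f \<and> poly_bounded (\<lambda>n. total_degree (f n)) \<and>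
     (\<exists>C. poly_bounded (\<lambda>n. length (C n)) \<and>
        (\<forall>n. is_circuit (C n) \<and> f n = circuit_value (C n)))}"


section \<open>Hypercube sums\<close>

definition bits :: "nat \<Rightarrow> (nat \<Rightarrow> 'a::comm_ring_1) set" where
  "bits p = (\<Pi>\<^sub>E i\<in>{..<p}. {0, 1})"

text \<open>\<open>plug p b g\<close> is \<open>g(b, x)\<close>: the first \<open>p\<close> variables of \<open>g\<close> are the hypercube variables and
  the remaining ones, \<open>Var p, Var (p + 1), \<dots>\<close>, stand for \<open>x = (Var 0, Var 1, \<dots>)\<close>.\<close>

definition plug :: "nat \<Rightarrow> (nat \<Rightarrow> 'a::comm_ring_1) \<Rightarrow> 'a mpoly \<Rightarrow> 'a mpoly" where
  "plug p b g = subst (\<lambda>i. if i < p then Const (b i) else Var (i - p)) g"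

definition N :: "'a::comm_ring_1 family set \<Rightarrow> 'a family set" where
  "N \<C> = {f. \<exists>g\<in>\<C>. \<exists>p q. poly_bounded p \<and> poly_bounded q \<and>
     (\<forall>n. f n = (\<Sum>b\<in>bits (p n). plug (p n) b (g (q n))))}"

definition VNP1 :: "'a::comm_ring_1 family set" where
  "VNP1 = N VP1"

text \<open>The class of p-definable families.\<close>

definition VNP :: "'a::comm_ring_1 family set" where
  "VNP = N VP"

end

theory Submission
  imports
    Defs
    "HOL-Library.Disjoint_Sets"
begin

text \<open>
  Only \<open>VNP \<subseteq> VNP\<^sub>1\<close> has content. Splitting a circuit into homogeneous components gives a weighted
  grammar: the component of degree \<open>k\<close> of a gate is a sum over rules of a weight times a product of
  components of earlier gates. Components of degree 0 are constants and are absorbed into the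
  weights, so a derivation from degree \<open>k\<close> has at most \<open>k\<close> leaves. Attaching to each component the
  interval of leaf positions it produces makes the two factors of a product disjoint, so that no
  component is ever used twice in a derivation. A derivation is then a set of rules, and a set
  of rules is a derivation iff at each component the number of chosen rules is at most one and equals
  the number of times the component is called for. These conditions and the weights are products of
  affine forms in the indicator bits of the rules and of factors \<open>1 + c (l - 1)\<close> with \<open>c\<close> a bit and
  \<open>l\<close> affine. If 2 is invertible, then for \<open>c \<in> {0, 1}\<close>
  \<open>1 + c (l - 1) = (\<Sum>x\<in>{0, 1}. (1 - 2 x + c / 2) (l - x - c / 2))\<close>,
  which turns the latter factors into products of affine forms at the cost of one more bit each.
\<close>

section \<open>Multivariate polynomials\<close>

abbreviation "monom_eval \<sigma> m \<equiv> (\<Prod>i\<in>Poly_Mapping.keys m. \<sigma> i ^ Poly_Mapping.lookup m i)"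

lemma Const_0 [simp]: "Const 0 = 0"
  by (simp add: Const_def)

lemma Const_1 [simp]: "Const 1 = 1"
  by (simp add: Const_def)

lemma Const_add: "Const (a + b) = Const a + Const b"
  by (simp add: Const_def single_add)

lemma Const_diff: "Const (a - b) = Const a - Const (b :: 'a::ab_group_add)"
  by (simp add: Const_def single_diff)

lemma Const_mult: "Const (a * b) = Const a * Const b"
  by (simp add: Const_def mult_single)

lemma poly_mapping_sum_single:
  "(\<Sum>m\<in>Poly_Mapping.keys f. Poly_Mapping.single m (Poly_Mapping.lookup f m)) = f"
proof (rule poly_mapping_eqI)
  fix k
  have "Poly_Mapping.lookup (\<Sum>m\<in>Poly_Mapping.keys f. Poly_Mapping.single m (Poly_Mapping.lookup f m)) k
      = (\<Sum>m\<in>Poly_Mapping.keys f. if m = k then Poly_Mapping.lookup f m else 0)"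
    by (simp add: lookup_sum lookup_single when_def)
  also have "\<dots> = Poly_Mapping.lookup f k"
    by (simp add: sum.delta in_keys_iff)
  finally show "Poly_Mapping.lookup (\<Sum>m\<in>Poly_Mapping.keys f. Poly_Mapping.single m (Poly_Mapping.lookup f m)) k
      = Poly_Mapping.lookup f k" .
qed

text \<open>Every polynomial is a finite sum of single terms. An identity additive in
  \<open>f\<close> therefore needs checking only on single terms; this gives multiplicativity of
  substitution and the product rule for homogeneous components.\<close>

lemma poly_mapping_additive_induct [case_names zero single add]:
  fixes f :: "'b \<Rightarrow>\<^sub>0 'c::comm_monoid_add"
  assumes "P 0" and "\<And>m c. P (Poly_Mapping.single m c)"
    and "\<And>f g. P f \<Longrightarrow> P g \<Longrightarrow> P (f + g)"
  shows "P f"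
proof -
  have "P (\<Sum>m\<in>A. Poly_Mapping.single m (Poly_Mapping.lookup f m))" if "finite A" for A
    using that by (induction A) (auto intro: assms)
  from this[OF finite_keys[of f]] show ?thesis
    by (simp add: poly_mapping_sum_single)
qed

section \<open>Substitution as a ring homomorphism\<close>

lemma subst_add: "subst \<sigma> (f + g) = subst \<sigma> f + subst \<sigma> g"
  unfolding subst_def
  by (rule setsum_keys_plus_distrib) (simp_all add: Const_add distrib_right)

lemma subst_0 [simp]: "subst \<sigma> 0 = 0"
  by (simp add: subst_def)

lemma subst_single: "subst \<sigma> (Poly_Mapping.single m c) = Const c * monom_eval \<sigma> m"
  by (cases "c = 0") (simp_all add: subst_def)

lemma monom_eval_superset:
  assumes "finite A" "Poly_Mapping.keys m \<subseteq> A"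
  shows "monom_eval \<sigma> m = (\<Prod>i\<in>A. \<sigma> i ^ Poly_Mapping.lookup m i)"
  by (rule prod.mono_neutral_left) (use assms in \<open>auto simp: in_keys_iff\<close>)

lemma monom_eval_add: "monom_eval \<sigma> (m + n) = monom_eval \<sigma> m * (monom_eval \<sigma> n :: 'a::comm_ring_1)"
proof -
  let ?A = "Poly_Mapping.keys m \<union> Poly_Mapping.keys n"
  have "monom_eval \<sigma> (m + n) = (\<Prod>i\<in>?A. \<sigma> i ^ Poly_Mapping.lookup (m + n) i)"
    by (rule monom_eval_superset) (simp_all add: keys_add)
  also have "\<dots> = (\<Prod>i\<in>?A. \<sigma> i ^ Poly_Mapping.lookup m i) * (\<Prod>i\<in>?A. \<sigma> i ^ Poly_Mapping.lookup n i)"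
    by (simp add: lookup_add power_add prod.distrib)
  also have "\<dots> = monom_eval \<sigma> m * monom_eval \<sigma> n"
    by (subst (1 2) monom_eval_superset[of ?A]) auto
  finally show ?thesis .
qed

text \<open>Both sides are additive in \<open>f\<close> and in \<open>g\<close>, so two nested
  inductions leave only products of two terms.\<close>

lemma subst_mult: "subst \<sigma> (f * g) = subst \<sigma> f * subst \<sigma> g"
proof (induction f rule: poly_mapping_additive_induct)
  case (single m c)
  show ?case
  proof (induction g rule: poly_mapping_additive_induct)
    case (single n d)
    then show ?case
      by (simp add: mult_single subst_single monom_eval_add Const_mult ac_simps)
  qed (simp_all add: subst_add distrib_left)
qed (simp_all add: subst_add distrib_right)

lemma subst_Const [simp]: "subst \<sigma> (Const c) = Const c"
  unfolding Const_def by (subst subst_single) (simp add: Const_def)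

lemma subst_1 [simp]: "subst \<sigma> 1 = 1"
  using subst_Const[of \<sigma> 1] by simp

lemma subst_Var [simp]: "subst \<sigma> (Var i) = \<sigma> i"
  unfolding Var_def by (subst subst_single) simp

lemma subst_sum: "subst \<sigma> (sum f A) = (\<Sum>i\<in>A. subst \<sigma> (f i))"
  by (induction A rule: infinite_finite_induct) (simp_all add: subst_add)

lemma subst_prod: "subst \<sigma> (prod f A) = (\<Prod>i\<in>A. subst \<sigma> (f i))"
  by (induction A rule: infinite_finite_induct) (simp_all add: subst_mult)

lemma subst_power: "subst \<sigma> (f ^ n) = subst \<sigma> f ^ n"
  by (induction n) (simp_all add: subst_mult)

lemma subst_subst: "subst \<tau> (subst \<sigma> f) = subst (\<lambda>i. subst \<tau> (\<sigma> i)) f"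
  by (induction f rule: poly_mapping_additive_induct)
    (simp_all add: subst_add subst_single subst_mult subst_prod subst_power)

lemma Var_power: "Var i ^ n = (Poly_Mapping.single (Poly_Mapping.single i n) 1 :: 'a::comm_ring_1 mpoly)"
  by (induction n) (simp_all add: Var_def mult_single flip: single_add)

lemma prod_single_1:
  "(\<Prod>i\<in>A. Poly_Mapping.single (h i) 1) = (Poly_Mapping.single (\<Sum>i\<in>A. h i) 1 :: 'a::comm_ring_1 mpoly)"
  by (induction A rule: infinite_finite_induct) (simp_all add: mult_single)

lemma monom_eval_Var: "monom_eval Var m = (Poly_Mapping.single m 1 :: 'a::comm_ring_1 mpoly)"
  by (simp add: Var_power prod_single_1 poly_mapping_sum_single)

lemma subst_Var_eq_self:
  fixes f :: "'a::comm_ring_1 mpoly"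
  assumes "\<And>i. i \<in> vars f \<Longrightarrow> \<sigma> i = Var i"
  shows "subst \<sigma> f = f"
proof -
  have "subst \<sigma> f = (\<Sum>m\<in>Poly_Mapping.keys f. Const (Poly_Mapping.lookup f m) * monom_eval Var m)"
    unfolding subst_def
  proof (intro sum.cong refl arg_cong2[of _ _ _ _ "(*)"] prod.cong)
    fix m i assume "m \<in> Poly_Mapping.keys f" "i \<in> Poly_Mapping.keys m"
    then have "\<sigma> i = Var i"
      by (intro assms) (auto simp: vars_def)
    then show "\<sigma> i ^ Poly_Mapping.lookup m i = Var i ^ Poly_Mapping.lookup m i"
      by simp
  qed
  also have "\<dots> = f"
    unfolding monom_eval_Var by (simp add: Const_def mult_single poly_mapping_sum_single)
  finally show ?thesis .
qed

section \<open>Occurring variables\<close>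

lemma vars_0 [simp]: "vars 0 = {}"
  by (simp add: vars_def)

lemma vars_Const [simp]: "vars (Const c) = {}"
  by (simp add: vars_def Const_def)

lemma vars_1 [simp]: "vars (1 :: 'a::comm_ring_1 mpoly) = {}"
  by (simp add: vars_def)

lemma vars_Var [simp]: "vars (Var i :: 'a::zero_neq_one mpoly) = {i}"
  by (simp add: vars_def Var_def)

lemma finite_vars [simp]: "finite (vars f)"
  by (simp add: vars_def)

lemma vars_add: "vars (f + g) \<subseteq> vars f \<union> vars g"
  unfolding vars_def using keys_add[of f g] by auto

lemma vars_mult: "vars (f * g) \<subseteq> vars f \<union> vars g"
  unfolding vars_def using keys_mult[of f g] keys_add by fastforce

lemma vars_sum: "vars (sum f A) \<subseteq> (\<Union>i\<in>A. vars (f i))"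
proof (induction A rule: infinite_finite_induct)
  case (insert x A)
  then show ?case using vars_add[of "f x" "sum f A"] by auto
qed simp_all

lemma vars_prod: "vars (prod f A :: 'a::comm_ring_1 mpoly) \<subseteq> (\<Union>i\<in>A. vars (f i))"
proof (induction A rule: infinite_finite_induct)
  case (insert x A)
  then show ?case using vars_mult[of "f x" "prod f A"] by auto
qed simp_all

lemma vars_affine_sum:
  fixes a :: "nat \<Rightarrow> 'a::comm_ring_1"
  shows "vars (Const c + (\<Sum>i\<in>V. Const (a i) * Var i)) \<subseteq> V"
proof -
  have "vars (\<Sum>i\<in>V. Const (a i) * Var i) \<subseteq> (\<Union>i\<in>V. {i})"
    by (rule order_trans[OF vars_sum]) (use vars_mult[of "Const (a _)" "Var _"] in fastforce)
  then show ?thesis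
    using vars_add[of "Const c" "\<Sum>i\<in>V. Const (a i) * Var i"] by auto
qed

section \<open>Degrees\<close>

lemma monom_degree_superset:
  assumes "finite A" "Poly_Mapping.keys m \<subseteq> A"
  shows "monom_degree m = (\<Sum>i\<in>A. Poly_Mapping.lookup m i)"
  unfolding monom_degree_def
  by (rule sum.mono_neutral_left) (use assms in \<open>auto simp: in_keys_iff\<close>)

lemma monom_degree_add: "monom_degree (m + n) = monom_degree m + monom_degree n"
proof -
  let ?A = "Poly_Mapping.keys m \<union> Poly_Mapping.keys n"
  have "Poly_Mapping.keys (m + n) \<subseteq> ?A"
    by (rule keys_add)
  then show ?thesis
    by (simp add: monom_degree_superset[of ?A] lookup_add sum.distrib)
qed

lemma monom_degree_0 [simp]: "monom_degree 0 = 0"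
  by (simp add: monom_degree_def)

lemma monom_degree_single [simp]: "monom_degree (Poly_Mapping.single i n) = n"
  by (cases "n = 0") (simp_all add: monom_degree_def)

lemma monom_degree_eq_0_iff: "monom_degree m = 0 \<longleftrightarrow> m = 0"
  by (auto simp: monom_degree_def in_keys_iff intro!: poly_mapping_eqI)

lemma total_degree_le_iff:
  "total_degree f \<le> d \<longleftrightarrow> (\<forall>m\<in>Poly_Mapping.keys f. monom_degree m \<le> d)"
  by (simp add: total_degree_def)

lemma total_degree_add_le: "total_degree f \<le> d \<Longrightarrow> total_degree g \<le> d \<Longrightarrow> total_degree (f + g) \<le> d"
  unfolding total_degree_le_iff using keys_add[of f g] by auto

lemma total_degree_mult_le:
  assumes "total_degree f \<le> d" "total_degree g \<le> e"
  shows "total_degree (f * g) \<le> d + e"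
  unfolding total_degree_le_iff
proof
  fix m assume "m \<in> Poly_Mapping.keys (f * g)"
  then obtain a b where "m = a + b" "a \<in> Poly_Mapping.keys f" "b \<in> Poly_Mapping.keys g"
    using keys_mult[of f g] by blast
  then show "monom_degree m \<le> d + e"
    using assms by (auto simp: total_degree_le_iff monom_degree_add intro: add_mono)
qed

lemma total_degree_Const [simp]: "total_degree (Const c) = 0"
  by (cases "c = 0") (simp_all add: total_degree_def Const_def)

lemma total_degree_Var [simp]: "total_degree (Var i :: 'a::zero_neq_one mpoly) = 1"
  by (simp add: total_degree_def Var_def)

lemma total_degree_sum_le: "(\<And>i. i \<in> A \<Longrightarrow> total_degree (f i) \<le> d) \<Longrightarrow> total_degree (sum f A) \<le> d"
  by (induction A rule: infinite_finite_induct)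
    (auto intro!: total_degree_add_le simp: total_degree_def[of 0])

lemma total_degree_prod_le:
  fixes f :: "'i \<Rightarrow> 'a::comm_ring_1 mpoly"
  shows "(\<And>i. i \<in> A \<Longrightarrow> total_degree (f i) \<le> 1) \<Longrightarrow> total_degree (prod f A) \<le> card A"
proof (induction A rule: infinite_finite_induct)
  case (insert x A)
  then show ?case
    using total_degree_mult_le[of "f x" 1 "prod f A" "card A"] by simp
qed (simp_all add: total_degree_def[of 1])

lemma total_degree_affine_form: "affine_form l \<Longrightarrow> total_degree l \<le> 1"
  unfolding affine_form_def
proof (elim exE conjE)
  fix c a V assume "l = Const c + (\<Sum>i\<in>V. Const (a i) * Var i)"
  moreover have "total_degree (Const (a i) * Var i) \<le> 1" for i
    using total_degree_mult_le[of "Const (a i)" 0 "Var i" 1] by simp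
  ultimately show ?thesis
    by (auto intro!: total_degree_add_le total_degree_sum_le)
qed

section \<open>Homogeneous components\<close>

lift_definition hom_comp :: "nat \<Rightarrow> 'a::zero mpoly \<Rightarrow> 'a mpoly"
  is "\<lambda>k f m. if monom_degree m = k then f m else 0"
  by (rule finite_subset[rotated]) auto

lemma hom_comp_0 [simp]: "hom_comp k 0 = 0"
  by transfer (simp add: fun_eq_iff)

lemma hom_comp_add: "hom_comp k (f + g) = hom_comp k f + hom_comp k g"
  by transfer (simp add: fun_eq_iff)

lemma hom_comp_single:
  "hom_comp k (Poly_Mapping.single m c) = (if monom_degree m = k then Poly_Mapping.single m c else 0)"
  by (rule poly_mapping_eqI) (auto simp: hom_comp.rep_eq lookup_single when_def)

lemma hom_comp_Const: "hom_comp k (Const c) = (if k = 0 then Const c else 0)"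
  by (simp add: Const_def hom_comp_single)

lemma hom_comp_Var: "hom_comp k (Var i :: 'a::comm_ring_1 mpoly) = (if k = 1 then Var i else 0)"
  by (simp add: Var_def hom_comp_single)

text \<open>Only the empty monomial has degree 0. Being constants, these components can later serve
  as rule weights and need no nodes of their own.\<close>

lemma hom_comp_degree_0: "hom_comp 0 f = Const (Poly_Mapping.lookup f 0)"
  by (rule poly_mapping_eqI)
    (auto simp: hom_comp.rep_eq Const_def lookup_single when_def monom_degree_eq_0_iff)

lemma hom_comp_mult:
  fixes f g :: "'a::comm_ring_1 mpoly"
  shows "hom_comp k (f * g) = (\<Sum>i\<le>k. hom_comp i f * hom_comp (k - i) g)"
proof (induction f rule: poly_mapping_additive_induct)
  case (single m c)
  show ?case
  proof (induction g rule: poly_mapping_additive_induct)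
    case (single n d)
    \<comment> \<open>Only \<open>i = monom_degree m\<close> can contribute; the nested conditionals
      let the sum collapse to that index.\<close>
    have "(\<Sum>i\<le>k. hom_comp i (Poly_Mapping.single m c) * hom_comp (k - i) (Poly_Mapping.single n d)) =
      (\<Sum>i\<le>k. if monom_degree m = i then (if monom_degree n = k - i then Poly_Mapping.single m c * Poly_Mapping.single n d else 0) else 0)"
      by (intro sum.cong) (auto simp: hom_comp_single)
    also have "\<dots> = hom_comp k (Poly_Mapping.single m c * Poly_Mapping.single n d)"
      by (auto simp: mult_single hom_comp_single monom_degree_add)
    finally show ?case ..
  qed (simp_all add: hom_comp_add distrib_left sum.distrib)
qed (simp_all add: hom_comp_add distrib_right sum.distrib)

lemma sum_hom_comp:
  assumes "total_degree f \<le> d"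
  shows "(\<Sum>k\<le>d. hom_comp k f) = f"
proof (rule poly_mapping_eqI)
  fix m
  have "Poly_Mapping.lookup (\<Sum>k\<le>d. hom_comp k f) m = (if monom_degree m \<le> d then Poly_Mapping.lookup f m else 0)"
    by (simp add: lookup_sum hom_comp.rep_eq)
  also have "\<dots> = Poly_Mapping.lookup f m"
    using assms by (auto simp: total_degree_le_iff in_keys_iff)
  finally show "Poly_Mapping.lookup (\<Sum>k\<le>d. hom_comp k f) m = Poly_Mapping.lookup f m" .
qed

section \<open>Sums over derivations\<close>

text \<open>A set of rules splits uniquely into the rules \<open>A\<close> chosen at
  \<open>u\<close> and the rules \<open>E\<close> chosen at the other nodes. This splits off one
  node in the induction over derivations.\<close>

lemma sum_Pow_insert_Times:
  fixes F :: "('n \<times> 't) set \<Rightarrow> 'b::comm_monoid_add"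
  assumes "u \<notin> U"
  shows "(\<Sum>E\<in>Pow (insert u U \<times> T). F E) = (\<Sum>A\<in>Pow T. \<Sum>E\<in>Pow (U \<times> T). F (Pair u ` A \<union> E))"
proof -
  have "(\<Sum>E\<in>Pow (insert u U \<times> T). F E) = (\<Sum>(A, E)\<in>Pow T \<times> Pow (U \<times> T). F (Pair u ` A \<union> E))"
    using assms
    by (intro sum.reindex_bij_witness[of _ "\<lambda>(A, E). Pair u ` A \<union> E"
          "\<lambda>E. ({t. (u, t) \<in> E}, {(v, t). (v, t) \<in> E \<and> v \<noteq> u})"])
      (auto intro!: arg_cong[of _ _ F])
  then show ?thesis
    by (simp add: sum.cartesian_product)
qed

lemma sum_Pow_singletons:
  fixes F :: "'t set \<Rightarrow> 'b::comm_semiring_1"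
  assumes "finite T"
  shows "(\<Sum>A\<in>Pow T. of_bool (\<exists>t. A = {t}) * F A) = (\<Sum>t\<in>T. F {t})"
proof -
  have "(\<Sum>A\<in>Pow T. of_bool (\<exists>t. A = {t}) * F A) = (\<Sum>A\<in>(\<lambda>t. {t}) ` T. of_bool (\<exists>t. A = {t}) * F A)"
    using assms by (intro sum.mono_neutral_right) auto
  also have "\<dots> = (\<Sum>t\<in>T. F {t})"
    by (subst sum.reindex) auto
  finally show ?thesis .
qed

text \<open>A node \<open>u\<close> has the rules \<open>(u, t)\<close> with weight \<open>w u t\<close> and right-hand side \<open>ch u t\<close>; \<open>S\<close> is the set of
  start symbols. The sets \<open>I u\<close> ensure that no node is called for twice, so the second argument of \<open>\<psi>\<close>
  is 0 or 1 and its other values are irrelevant; in particular the characteristic plays no role.\<close>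

lemma sum_derivations:
  fixes H :: "'n \<Rightarrow> 'b::comm_ring_1" and w :: "'n \<Rightarrow> 't \<Rightarrow> 'b" and ch :: "'n \<Rightarrow> 't \<Rightarrow> 'n set"
    and I :: "'n \<Rightarrow> 'p set" and rank :: "'n \<Rightarrow> nat" and \<psi> :: "'t set \<Rightarrow> 'b \<Rightarrow> 'b"
  assumes T: "finite T"
    and \<psi>0: "\<And>A. A \<subseteq> T \<Longrightarrow> \<psi> A 0 = of_bool (A = {})"
    and \<psi>1: "\<And>A. A \<subseteq> T \<Longrightarrow> \<psi> A 1 = of_bool (\<exists>t. A = {t})"
    and U: "finite U"
    and ch: "\<And>u t. u \<in> U \<Longrightarrow> t \<in> T \<Longrightarrow> ch u t \<subseteq> U"
    and rank: "\<And>u t c. u \<in> U \<Longrightarrow> t \<in> T \<Longrightarrow> c \<in> ch u t \<Longrightarrow> rank c < rank u"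
    and I_sub: "\<And>u t c. u \<in> U \<Longrightarrow> t \<in> T \<Longrightarrow> c \<in> ch u t \<Longrightarrow> I c \<subseteq> I u"
    and I_ne: "\<And>u t c. u \<in> U \<Longrightarrow> t \<in> T \<Longrightarrow> c \<in> ch u t \<Longrightarrow> I c \<noteq> {}"
    and I_disj: "\<And>u t. u \<in> U \<Longrightarrow> t \<in> T \<Longrightarrow> disjoint_family_on I (ch u t)"
    and H: "\<And>u. u \<in> U \<Longrightarrow> H u = (\<Sum>t\<in>T. w u t * (\<Prod>c\<in>ch u t. H c))"
    and S: "S \<subseteq> U" "disjoint_family_on I S"
  shows "(\<Sum>E\<in>Pow (U \<times> T). (\<Prod>u\<in>U. \<psi> {t. (u, t) \<in> E}
            (of_bool (u \<in> S) + (\<Sum>(v, t)\<in>E. of_bool (u \<in> ch v t)))) * (\<Prod>(v, t)\<in>E. w v t))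
       = (\<Prod>u\<in>S. H u)"
  using U ch rank I_sub I_ne I_disj H S
\<comment> \<open>Nodes enter by increasing rank, so the new node \<open>u\<close> has maximal rank
  and no rule calls for it. \<open>S\<close> has to vary, since applying a rule at \<open>u\<close>
  replaces \<open>u\<close> by its right-hand side among the start symbols.\<close>
proof (induction U arbitrary: S rule: finite_ranking_induct[where f = rank])
  case empty
  then show ?case by simp
next
  case (insert u U)
  show ?case
  \<comment> \<open>The ranking induction does not provide a fresh \<open>u\<close>; a repeated node
    leaves the set as it was.\<close>
  proof (cases "u \<in> U")
    case True
    then have "insert u U = U" by auto
    then show ?thesis using insert.IH[of S] insert.prems by auto
  next
    case u: False
    have no_parent: "u \<notin> ch v t" if "v \<in> insert u U" "t \<in> T" for v t
      using insert.prems(2)[OF that] insert.hyps(2)[of v] that by fastforce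
    have finE: "finite E" if "E \<subseteq> U \<times> T" for E
      using that T insert.hyps(1) by (meson finite_SigmaI finite_subset)
    have IH: "(\<Sum>E\<in>Pow (U \<times> T). (\<Prod>u\<in>U. \<psi> {t. (u, t) \<in> E}
            (of_bool (u \<in> S') + (\<Sum>(v, t)\<in>E. of_bool (u \<in> ch v t)))) * (\<Prod>(v, t)\<in>E. w v t))
       = (\<Prod>u\<in>S'. H u)" if "S' \<subseteq> U" "disjoint_family_on I S'" for S'
    proof (rule insert.IH)
      show "ch v t \<subseteq> U" if "v \<in> U" "t \<in> T" for v t
        using insert.prems(1)[of v t] no_parent[of v t] that by auto
      show "I c \<noteq> {}" if "v \<in> U" "t \<in> T" "c \<in> ch v t" for v t c
        using insert.prems(4)[of v t c] that by simp
    qed (use insert.prems that in auto)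
    \<comment> \<open>\<open>X A\<close> is what remains besides the factor \<open>\<psi>\<close> at
      \<open>u\<close> once the rules \<open>A\<close> are fixed there; their right-hand sides are
      added to the demand at the other nodes.\<close>
    define X where "X A = (\<Prod>t\<in>A. w u t) * (\<Sum>E\<in>Pow (U \<times> T). (\<Prod>v\<in>U. \<psi> {t. (v, t) \<in> E}
          (of_bool (v \<in> S) + (\<Sum>t\<in>A. of_bool (v \<in> ch u t)) + (\<Sum>(v', t)\<in>E. of_bool (v \<in> ch v' t))))
            * (\<Prod>(v, t)\<in>E. w v t))" for A
    have step: "(\<Sum>E\<in>Pow (insert u U \<times> T). (\<Prod>u\<in>insert u U. \<psi> {t. (u, t) \<in> E}
            (of_bool (u \<in> S) + (\<Sum>(v, t)\<in>E. of_bool (u \<in> ch v t)))) * (\<Prod>(v, t)\<in>E. w v t))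
        = (\<Sum>A\<in>Pow T. \<psi> A (of_bool (u \<in> S)) * X A)"
      unfolding sum_Pow_insert_Times[OF u] X_def sum_distrib_left
    proof (intro sum.cong refl)
      fix A E assume A: "A \<in> Pow T" and E: "E \<in> Pow (U \<times> T)"
      have fA: "finite A" and fE: "finite E"
        using A T finite_subset E finE by auto
      have disj: "Pair u ` A \<inter> E = {}"
        using u E by auto
      have split: "(\<Sum>(v, t)\<in>Pair u ` A \<union> E. g v t) = (\<Sum>t\<in>A. g u t) + (\<Sum>(v, t)\<in>E. g v t)"
        for g :: "'n \<Rightarrow> 't \<Rightarrow> 'b"
        using disj fA fE by (subst sum.union_disjoint) (auto simp: sum.reindex inj_on_def)
      have splitp: "(\<Prod>(v, t)\<in>Pair u ` A \<union> E. w v t) = (\<Prod>t\<in>A. w u t) * (\<Prod>(v, t)\<in>E. w v t)"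
        using disj fA fE by (subst prod.union_disjoint) (auto simp: prod.reindex inj_on_def)
      have z: "(\<Sum>(v, t)\<in>Pair u ` A \<union> E. of_bool (u \<in> ch v t)) = (0 :: 'b)"
        using A E no_parent by (intro sum.neutral) auto
      have "{t. (u, t) \<in> Pair u ` A \<union> E} = A"
        using u E by auto
      moreover have "{t. (v, t) \<in> Pair u ` A \<union> E} = {t. (v, t) \<in> E}" if "v \<in> U" for v
        using u that by auto
      ultimately show "(\<Prod>v\<in>insert u U. \<psi> {t. (v, t) \<in> Pair u ` A \<union> E}
            (of_bool (v \<in> S) + (\<Sum>(v', t)\<in>Pair u ` A \<union> E. of_bool (v \<in> ch v' t))))
              * (\<Prod>(v, t)\<in>Pair u ` A \<union> E. w v t)
         = \<psi> A (of_bool (u \<in> S)) * ((\<Prod>t\<in>A. w u t) * ((\<Prod>v\<in>U. \<psi> {t. (v, t) \<in> E}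
          (of_bool (v \<in> S) + (\<Sum>t\<in>A. of_bool (v \<in> ch u t)) + (\<Sum>(v', t)\<in>E. of_bool (v \<in> ch v' t))))
            * (\<Prod>(v, t)\<in>E. w v t)))"
        using u insert.hyps(1) by (simp add: z splitp) (simp add: split add.assoc mult_ac)
    qed
    show ?thesis
    proof (cases "u \<in> S")
      case False
      \<comment> \<open>Nothing calls for \<open>u\<close>, so \<open>\<psi>\<close> leaves only
        \<open>A = {}\<close>.\<close>
      have "(\<Sum>A\<in>Pow T. \<psi> A (of_bool (u \<in> S)) * X A) = (\<Sum>A\<in>Pow T. if A = {} then X {} else 0)"
        using False by (intro sum.cong) (auto simp: \<psi>0)
      also have "\<dots> = X {}"
        using T by simp
      also have "\<dots> = (\<Prod>u\<in>S. H u)"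
        using IH[of S] insert.prems(7,8) False unfolding X_def by auto
      finally show ?thesis unfolding step .
    next
      case True
      have fS: "finite S"
        using insert.prems(7) insert.hyps(1) finite_subset by auto
      have X: "X {t} = w u t * (\<Prod>c\<in>ch u t. H c) * (\<Prod>v\<in>S - {u}. H v)" if t: "t \<in> T" for t
      proof -
        have sub: "I c \<subseteq> I u" "I c \<noteq> {}" if "c \<in> ch u t" for c
          using insert.prems(3,4)[of u t c] that t by auto
        have outside: "I c \<inter> I v = {}" if "c \<in> ch u t" "v \<in> S - {u}" for c v
          using sub[OF that(1)] insert.prems(8) True that(2) unfolding disjoint_family_on_def by blast
        \<comment> \<open>Nonemptiness matters here: a common element would have an interval
          disjoint from itself.\<close>
        have disj: "ch u t \<inter> (S - {u}) = {}"
          using outside sub by blast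
        \<comment> \<open>Rule \<open>t\<close> trades the start symbol \<open>u\<close> for its
          right-hand side. The new intervals lie inside \<open>I u\<close> and so avoid those of the
          other start symbols, which makes the induction hypothesis applicable to
          \<open>S'\<close>.\<close>
        define S' where "S' = ch u t \<union> (S - {u})"
        have S'U: "S' \<subseteq> U"
          using insert.prems(1)[of u t] insert.prems(7) no_parent[of u t] t by (auto simp: S'_def)
        have "disjoint_family_on I S'"
          unfolding disjoint_family_on_def
        proof (intro ballI impI)
          fix x y assume xy: "x \<in> S'" "y \<in> S'" "x \<noteq> y"
          have "disjoint_family_on I (ch u t)"
            using insert.prems(5)[of u t] t by auto
          then show "I x \<inter> I y = {}"
            using xy outside[of x y] outside[of y x] insert.prems(8)
            unfolding disjoint_family_on_def S'_def by blast
        qed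
        note IH' = IH[OF S'U this]
        \<comment> \<open>The two parts of \<open>S'\<close> are disjoint, so the demand never
          reaches 2 and is again the indicator of a set of start symbols.\<close>
        have "of_bool (v \<in> S) + (\<Sum>t\<in>{t}. of_bool (v \<in> ch u t)) = (of_bool (v \<in> S') :: 'b)" if "v \<in> U" for v
          using disj that u by (auto simp: S'_def simp del: sum_of_bool_eq)
        then have "X {t} = w u t * (\<Prod>v\<in>S'. H v)"
          unfolding X_def IH'[symmetric] by simp
        also have "(\<Prod>v\<in>S'. H v) = (\<Prod>c\<in>ch u t. H c) * (\<Prod>v\<in>S - {u}. H v)"
          using disj fS insert.prems(1)[of u t] t insert.hyps(1) unfolding S'_def
          by (intro prod.union_disjoint) (auto intro: finite_subset[of _ "insert u U"])
        finally show ?thesis by (simp add: mult.assoc)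
      qed
      \<comment> \<open>With \<open>u\<close> called for once, \<open>\<psi>\<close> leaves exactly
        the singletons; summing over the single rule reproduces the recursion for
        \<open>H u\<close>.\<close>
      have "(\<Sum>A\<in>Pow T. \<psi> A (of_bool (u \<in> S)) * X A) = (\<Sum>A\<in>Pow T. of_bool (\<exists>t. A = {t}) * X A)"
        using True by (intro sum.cong) (auto simp: \<psi>1)
      also have "\<dots> = (\<Sum>t\<in>T. X {t})"
        by (rule sum_Pow_singletons[OF T])
      also have "\<dots> = (\<Sum>t\<in>T. w u t * (\<Prod>c\<in>ch u t. H c)) * (\<Prod>v\<in>S - {u}. H v)"
        by (simp add: X sum_distrib_right)
      also have "\<dots> = (\<Prod>v\<in>S. H v)"
        using True fS insert.prems(6)[of u] by (simp add: prod.remove)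
      finally show ?thesis unfolding step .
    qed
  qed
qed

text \<open>The factors of \<open>e\<close> exclude two chosen rules; they are written in the form \<open>1 + c (l - 1)\<close>.\<close>

lemma exactly_indicator:
  fixes T :: "'t::linorder set" and A :: "'t set"
  defines "a \<equiv> (\<Sum>t\<in>T. of_bool (t \<in> A)) :: 'b::comm_ring_1"
    and "e \<equiv> (\<Prod>(t, t')\<in>{(t, t'). t \<in> T \<and> t' \<in> T \<and> t < t'}. 1 + of_bool (t \<in> A) * (1 - of_bool (t' \<in> A) - 1) :: 'b)"
  assumes "finite T" "A \<subseteq> T"
  shows "(1 - a + 0) * (1 + a - 0) * e = of_bool (A = {})"
    and "(1 - a + 1) * (1 + a - 1) * e = of_bool (\<exists>t. A = {t})"
proof -
  have a: "a = of_nat (card A)"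
    using assms by (simp add: a_def Int_absorb1)
  have fin: "finite {(t, t'). t \<in> T \<and> t' \<in> T \<and> t < t'}"
    by (rule finite_subset[of _ "T \<times> T"]) (use assms in auto)
  \<comment> \<open>For demand \<open>b\<close> the first two factors multiply to
    \<open>1 - (a - b)^2\<close>, which tests \<open>a = b\<close> when both are 0 or 1. Two
    distinct elements of \<open>A\<close> make \<open>e\<close> vanish, so no larger
    \<open>a\<close> has to be tested.\<close>
  consider "A = {}" | t where "A = {t}" | t t' where "t \<in> A" "t' \<in> A" "t < t'"
    by (metis all_not_in_conv insertI1 linorder_less_linear subsetI subset_singletonD singletonI insertE insert_absorb
        subset_antisym subset_insertI)
  then have "(1 - a + 0) * (1 + a - 0) * e = of_bool (A = {}) \<and> (1 - a + 1) * (1 + a - 1) * e = of_bool (\<exists>t. A = {t})"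
  proof cases
    case 1
    then show ?thesis by (simp add: a e_def case_prod_unfold)
  next
    case (2 t)
    then have "e = 1"
      unfolding e_def by (intro prod.neutral) auto
    then show ?thesis using 2 by (simp add: a)
  next
    case (3 t t')
    then have "e = 0"
      unfolding e_def using assms(3,4) fin by (intro prod_zero[OF fin]) (auto intro!: bexI[of _ "(t, t')"])
    moreover have "\<not> (\<exists>t. A = {t})" "A \<noteq> {}"
      using 3 by auto
    ultimately show ?thesis by simp
  qed
  then show "(1 - a + 0) * (1 + a - 0) * e = of_bool (A = {})"
    and "(1 - a + 1) * (1 + a - 1) * e = of_bool (\<exists>t. A = {t})" by auto
qed

section \<open>Hypercube sums of products of affine forms\<close>

lemma plug_Const [simp]: "plug p b (Const c) = Const c"
  by (simp add: plug_def)

lemma plug_add: "plug p b (f + g) = plug p b f + plug p b g"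
  by (simp add: plug_def subst_add)

lemma plug_mult: "plug p b (f * g) = plug p b f * plug p b g"
  by (simp add: plug_def subst_mult)

lemma plug_sum: "plug p b (sum f A) = (\<Sum>i\<in>A. plug p b (f i))"
  by (simp add: plug_def subst_sum)

lemma plug_prod: "plug p b (prod f A) = (\<Prod>i\<in>A. plug p b (f i))"
  by (simp add: plug_def subst_prod)

lemma plug_Var: "plug p b (Var i) = (if i < p then Const (b i) else Var (i - p))"
  by (simp add: plug_def)

text \<open>A bit vector is encoded as a subset of an arbitrary index set \<open>B\<close>, so that
  rules themselves can index bits; numbering them is postponed to \<open>hypercube_productI\<close>.
  The coefficients are chosen uniformly in \<open>S\<close>.\<close>

definition affine_in_bits :: "nat set \<Rightarrow> 'i set \<Rightarrow> ('i set \<Rightarrow> 'a::comm_ring_1 mpoly) \<Rightarrow> bool" where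
  "affine_in_bits V B F \<longleftrightarrow> (\<exists>c a \<beta>. \<forall>S\<subseteq>B.
     F S = Const c + (\<Sum>i\<in>V. Const (a i) * Var i) + (\<Sum>i\<in>S. Const (\<beta> i)))"

lemma affine_in_bitsI:
  assumes "\<And>S. S \<subseteq> B \<Longrightarrow> F S = Const c + (\<Sum>i\<in>V. Const (a i) * Var i) + (\<Sum>i\<in>S. Const (\<beta> i))"
  shows "affine_in_bits V B F"
  using assms unfolding affine_in_bits_def by blast

lemma affine_in_bits_Const: "affine_in_bits V B (\<lambda>S. Const c)"
  by (rule affine_in_bitsI[where c = c and a = "\<lambda>_. 0" and \<beta> = "\<lambda>_. 0"]) simp

lemma affine_in_bits_of_bool: "affine_in_bits V B (\<lambda>S. of_bool b)"
  using affine_in_bits_Const[of V B "of_bool b"] by (cases b) simp_all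

lemma affine_in_bits_0: "affine_in_bits V B (\<lambda>S. 0)"
  using affine_in_bits_of_bool[of V B False] by simp

lemma affine_in_bits_1: "affine_in_bits V B (\<lambda>S. 1)"
  using affine_in_bits_of_bool[of V B True] by simp

lemma affine_in_bits_Var:
  assumes "finite V" "i \<in> V"
  shows "affine_in_bits V B (\<lambda>S. Var i :: 'a::comm_ring_1 mpoly)"
proof (rule affine_in_bitsI[where c = 0 and a = "\<lambda>j. if j = i then 1 else 0" and \<beta> = "\<lambda>_. 0"])
  have "(\<Sum>j\<in>V. Const (if j = i then 1 else 0) * Var j) = (\<Sum>j\<in>V. if j = i then Var j else (0 :: 'a mpoly))"
    by (intro sum.cong) auto
  also have "\<dots> = Var i"
    using assms by simp
  finally show "Var i = Const 0 + (\<Sum>j\<in>V. Const (if j = i then 1 else 0) * Var j) + (\<Sum>j\<in>S. Const (0 :: 'a))" for S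
    by simp
qed

lemma affine_in_bits_mem:
  assumes "finite B"
  shows "affine_in_bits V B (\<lambda>S. of_bool (i \<in> S) :: 'a::comm_ring_1 mpoly)"
proof (rule affine_in_bitsI[where c = 0 and a = "\<lambda>_. 0" and \<beta> = "\<lambda>j. of_bool (j = i)"])
  fix S assume "S \<subseteq> B"
  then have "finite S" using assms finite_subset by blast
  moreover have "(\<Sum>j\<in>S. Const (of_bool (j = i))) = (\<Sum>j\<in>S. if j = i then 1 else (0 :: 'a mpoly))"
    by (intro sum.cong) auto
  ultimately show "of_bool (i \<in> S) = Const 0 + (\<Sum>j\<in>V. Const 0 * Var j) + (\<Sum>j\<in>S. Const (of_bool (j = i) :: 'a))"
    by simp
qed

lemma affine_in_bits_add:
  assumes "affine_in_bits V B F" "affine_in_bits V B G"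
  shows "affine_in_bits V B (\<lambda>S. F S + G S)"
proof -
  obtain c a \<beta> where F: "\<forall>S\<subseteq>B. F S = Const c + (\<Sum>i\<in>V. Const (a i) * Var i) + (\<Sum>i\<in>S. Const (\<beta> i))"
    using assms(1) unfolding affine_in_bits_def by blast
  obtain c' a' \<beta>' where G: "\<forall>S\<subseteq>B. G S = Const c' + (\<Sum>i\<in>V. Const (a' i) * Var i) + (\<Sum>i\<in>S. Const (\<beta>' i))"
    using assms(2) unfolding affine_in_bits_def by blast
  show ?thesis
    by (rule affine_in_bitsI[where c = "c + c'" and a = "\<lambda>i. a i + a' i" and \<beta> = "\<lambda>i. \<beta> i + \<beta>' i"])
      (simp add: F G Const_add sum.distrib distrib_right add_ac)
qed

lemma affine_in_bits_cmult:
  assumes "affine_in_bits V B F"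
  shows "affine_in_bits V B (\<lambda>S. Const k * F S)"
proof -
  obtain c a \<beta> where F: "\<forall>S\<subseteq>B. F S = Const c + (\<Sum>i\<in>V. Const (a i) * Var i) + (\<Sum>i\<in>S. Const (\<beta> i))"
    using assms(1) unfolding affine_in_bits_def by blast
  show ?thesis
    by (rule affine_in_bitsI[where c = "k * c" and a = "\<lambda>i. k * a i" and \<beta> = "\<lambda>i. k * \<beta> i"])
      (simp add: F Const_mult distrib_left sum_distrib_left mult.assoc)
qed

lemma affine_in_bits_diff:
  fixes F G :: "'i set \<Rightarrow> 'a::comm_ring_1 mpoly"
  assumes "affine_in_bits V B F" "affine_in_bits V B G"
  shows "affine_in_bits V B (\<lambda>S. F S - G S)"
proof -
  have "Const (-1) = (-1 :: 'a mpoly)"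
    using Const_diff[of 0 "1 :: 'a"] by simp
  then show ?thesis
    using affine_in_bits_add[OF assms(1) affine_in_bits_cmult[OF assms(2), of "-1"]] by simp
qed

lemma affine_in_bits_sum:
  fixes F :: "'j \<Rightarrow> 'i set \<Rightarrow> 'a::comm_ring_1 mpoly"
  assumes "\<And>j. j \<in> J \<Longrightarrow> affine_in_bits V B (F j)"
  shows "affine_in_bits V B (\<lambda>S. \<Sum>j\<in>J. F j S)"
  using assms
proof (induction J rule: infinite_finite_induct)
  case (insert x J)
  then show ?case using affine_in_bits_add[of V B "F x"] by simp
qed (simp_all add: affine_in_bits_0)

lemma Inl_vimage_Plus_Inr_vimage: "Inl -` S <+> Inr -` S = S"
proof (rule set_eqI)
  fix x show "x \<in> Inl -` S <+> Inr -` S \<longleftrightarrow> x \<in> S"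
    by (cases x) auto
qed

text \<open>The additional bits from \<open>K\<close> get coefficient 0.\<close>

lemma affine_in_bits_Inl_vimage:
  fixes F :: "'i set \<Rightarrow> 'a::comm_ring_1 mpoly" and K :: "'k set"
  assumes "affine_in_bits V B F" "finite B" "finite K"
  shows "affine_in_bits V (B <+> K) (\<lambda>S. F (Inl -` S))"
proof -
  obtain c a \<beta> where F: "\<forall>S\<subseteq>B. F S = Const c + (\<Sum>i\<in>V. Const (a i) * Var i) + (\<Sum>i\<in>S. Const (\<beta> i))"
    using assms(1) unfolding affine_in_bits_def by blast
  show ?thesis
  proof (rule affine_in_bitsI[where c = c and a = a and \<beta> = "case_sum \<beta> (\<lambda>_. 0)"])
    fix S :: "('i + 'k) set" assume S: "S \<subseteq> B <+> K"
    have sub: "Inl -` S \<subseteq> B" "Inr -` S \<subseteq> K"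
      using S by auto
    have fin: "finite (Inl -` S)" "finite (Inr -` S)"
      using sub assms(2,3) finite_subset by blast+
    have "(\<Sum>i\<in>S. Const (case_sum \<beta> (\<lambda>_. 0) i)) = (\<Sum>i\<in>Inl -` S. Const (\<beta> i))"
      by (subst Inl_vimage_Plus_Inr_vimage[symmetric], subst sum.Plus) (simp_all add: fin)
    then show "F (Inl -` S) = Const c + (\<Sum>i\<in>V. Const (a i) * Var i) + (\<Sum>i\<in>S. Const (case_sum \<beta> (\<lambda>_. 0) i))"
      using F sub(1) by simp
  qed
qed

lemmas affine_in_bits_intros =
  affine_in_bits_Const affine_in_bits_1 affine_in_bits_of_bool affine_in_bits_Var affine_in_bits_mem
  affine_in_bits_add affine_in_bits_cmult affine_in_bits_diff affine_in_bits_sum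

text \<open>The bound on the variables, with \<open>V\<close> shifted by \<open>P\<close> as
  \<open>plug\<close> expects, is recorded so that the variables of a family can be counted
  later.\<close>

definition hypercube_product :: "nat set \<Rightarrow> nat \<Rightarrow> nat \<Rightarrow> 'a::comm_ring_1 mpoly \<Rightarrow> bool" where
  "hypercube_product V P Q g \<longleftrightarrow> (\<exists>l. (\<forall>i<Q. affine_form (l i) \<and> vars (l i) \<subseteq> {..<P} \<union> (+) P ` V) \<and>
     g = (\<Sum>b\<in>bits P. \<Prod>i<Q. plug P b (l i)))"

text \<open>Numbering \<open>B\<close> turns subsets into 0-1 vectors: bit \<open>i\<close> records
  whether the \<open>i\<close>-th element belongs to \<open>S\<close>. Numbering \<open>J\<close>
  orders the factors.\<close>

lemma hypercube_productI:
  fixes F :: "'j \<Rightarrow> 'i set \<Rightarrow> 'a::comm_ring_1 mpoly"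
  assumes V: "finite V" and B: "finite B" and J: "finite J"
    and F: "\<And>j. j \<in> J \<Longrightarrow> affine_in_bits V B (F j)"
  shows "hypercube_product V (card B) (card J) (\<Sum>S\<in>Pow B. \<Prod>j\<in>J. F j S)"
proof -
  let ?P = "card B" and ?Q = "card J"
  obtain e where e: "bij_betw e {..<?P} B"
    using ex_bij_betw_nat_finite[OF B] by (auto simp: atLeast0LessThan)
  obtain e' where e': "bij_betw e' {..<?Q} J"
    using ex_bij_betw_nat_finite[OF J] by (auto simp: atLeast0LessThan)
  have "\<forall>j\<in>J. \<exists>c a \<beta>. \<forall>S\<subseteq>B. F j S = Const c + (\<Sum>i\<in>V. Const (a i) * Var i) + (\<Sum>i\<in>S. Const (\<beta> i))"
    using F unfolding affine_in_bits_def by blast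
  from bchoice[OF this] obtain c where "\<forall>j\<in>J. \<exists>a \<beta>. \<forall>S\<subseteq>B. F j S = Const (c j) + (\<Sum>i\<in>V. Const (a i) * Var i) + (\<Sum>i\<in>S. Const (\<beta> i))"
    by blast
  from bchoice[OF this] obtain a where "\<forall>j\<in>J. \<exists>\<beta>. \<forall>S\<subseteq>B. F j S = Const (c j) + (\<Sum>i\<in>V. Const (a j i) * Var i) + (\<Sum>i\<in>S. Const (\<beta> i))"
    by blast
  from bchoice[OF this] obtain \<beta> where F': "\<And>j S. j \<in> J \<Longrightarrow> S \<subseteq> B \<Longrightarrow>
      F j S = Const (c j) + (\<Sum>i\<in>V. Const (a j i) * Var i) + (\<Sum>i\<in>S. Const (\<beta> j i))"
    by blast
  define W where "W = {..<?P} \<union> (+) ?P ` V"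
  \<comment> \<open>Variables below \<open>?P\<close> are the bits and take their coefficients from
    \<open>\<beta>\<close>; the others are the variables in \<open>V\<close>, shifted up by
    \<open>?P\<close>.\<close>
  define a' where "a' j i = (if i < ?P then \<beta> j (e i) else a j (i - ?P))" for j i
  define l where "l q = Const (c (e' q)) + (\<Sum>i\<in>W. Const (a' (e' q) i) * Var i)" for q
  have finW: "finite W"
    using V by (simp add: W_def)
  have "affine_form (l q)" for q
    unfolding affine_form_def l_def using finW by blast
  moreover have "vars (l q) \<subseteq> W" for q
    unfolding l_def by (rule vars_affine_sum)
  moreover have "(\<Sum>S\<in>Pow B. \<Prod>j\<in>J. F j S) = (\<Sum>b\<in>bits ?P. \<Prod>q<?Q. plug ?P b (l q))"
  proof -
    have plug_l: "plug ?P b (l q) = Const (c (e' q)) + (\<Sum>i\<in>V. Const (a (e' q) i) * Var i)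
        + (\<Sum>i<?P. Const (\<beta> (e' q) (e i)) * Const (b i))" for b q
    proof -
      have "(\<Sum>i\<in>W. plug ?P b (Const (a' (e' q) i) * Var i))
          = (\<Sum>i<?P. plug ?P b (Const (a' (e' q) i) * Var i)) + (\<Sum>i\<in>(+) ?P ` V. plug ?P b (Const (a' (e' q) i) * Var i))"
        unfolding W_def using V by (intro sum.union_disjoint) auto
      also have "(\<Sum>i\<in>(+) ?P ` V. plug ?P b (Const (a' (e' q) i) * Var i)) = (\<Sum>i\<in>V. Const (a (e' q) i) * Var i)"
        by (subst sum.reindex) (auto simp: plug_mult plug_Var a'_def)
      finally show ?thesis
        by (simp add: l_def plug_add plug_sum) (simp add: plug_mult plug_Var a'_def)
    qed
    show ?thesis
    proof (rule sum.reindex_bij_witness[of _ "\<lambda>b. e ` {i. i < ?P \<and> b i = 1}" "\<lambda>S. \<lambda>i\<in>{..<?P}. of_bool (e i \<in> S)"])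
      fix S assume "S \<in> Pow B"
      then have S: "S \<subseteq> B" by simp
      show "e ` {i. i < ?P \<and> (\<lambda>i\<in>{..<?P}. of_bool (e i \<in> S)) i = (1 :: 'a)} = S"
      proof (intro equalityI subsetI)
        fix x assume "x \<in> S"
        then obtain i where "i < ?P" "x = e i"
          using S e unfolding bij_betw_def by blast
        then show "x \<in> e ` {i. i < ?P \<and> (\<lambda>i\<in>{..<?P}. of_bool (e i \<in> S)) i = (1 :: 'a)}"
          using \<open>x \<in> S\<close> by auto
      qed auto
      show "(\<lambda>i\<in>{..<?P}. of_bool (e i \<in> S)) \<in> bits ?P"
        by (auto simp: bits_def)
      have lin: "(\<Sum>i<?P. Const (\<beta> j (e i)) * Const (of_bool (e i \<in> S))) = (\<Sum>i\<in>S. Const (\<beta> j i))" for j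
      proof -
        have "(\<Sum>i<?P. Const (\<beta> j (e i)) * Const (of_bool (e i \<in> S))) = (\<Sum>x\<in>B. Const (\<beta> j x) * Const (of_bool (x \<in> S)))"
          by (rule sum.reindex_bij_betw[OF e])
        also have "\<dots> = (\<Sum>x\<in>S. Const (\<beta> j x) * Const (of_bool (x \<in> S)))"
          using S B by (intro sum.mono_neutral_right) auto
        finally show ?thesis by simp
      qed
      have "(\<Prod>q<?Q. plug ?P (\<lambda>i\<in>{..<?P}. of_bool (e i \<in> S)) (l q)) = (\<Prod>q<?Q. F (e' q) S)"
      proof (rule prod.cong)
        fix q assume "q \<in> {..<?Q}"
        then have "e' q \<in> J" using e' unfolding bij_betw_def by auto
        then show "plug ?P (\<lambda>i\<in>{..<?P}. of_bool (e i \<in> S)) (l q) = F (e' q) S"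
          by (simp add: plug_l F' S lin cong: sum.cong_simp)
      qed simp
      also have "\<dots> = (\<Prod>j\<in>J. F j S)"
        by (rule prod.reindex_bij_betw[OF e'])
      finally show "(\<Prod>q<?Q. plug ?P (\<lambda>i\<in>{..<?P}. of_bool (e i \<in> S)) (l q)) = (\<Prod>j\<in>J. F j S)" .
    next
      fix b :: "nat \<Rightarrow> 'a" assume b: "b \<in> bits ?P"
      show "e ` {i. i < ?P \<and> b i = 1} \<in> Pow B"
        using e unfolding bij_betw_def by auto
      have inj: "e i = e i' \<Longrightarrow> i < ?P \<Longrightarrow> i' < ?P \<Longrightarrow> i = i'" for i i'
        using e unfolding bij_betw_def inj_on_def by auto
      show "(\<lambda>i\<in>{..<?P}. of_bool (e i \<in> e ` {i. i < ?P \<and> b i = 1})) = b"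
      proof
        fix i show "(\<lambda>i\<in>{..<?P}. of_bool (e i \<in> e ` {i. i < ?P \<and> b i = 1})) i = b i"
        proof (cases "i < ?P")
          case True
          then have "b i = 0 \<or> b i = 1"
            using b by (auto simp: bits_def PiE_iff)
          moreover have "e i \<in> e ` {i. i < ?P \<and> b i = 1} \<longleftrightarrow> b i = 1"
            using True inj by auto
          ultimately show ?thesis using True by auto
        next
          case False
          then show ?thesis using b by (auto simp: bits_def PiE_iff extensional_def)
        qed
      qed
    qed
  qed
  ultimately show ?thesis
    unfolding hypercube_product_def W_def by blast
qed

text \<open>The two summands are \<open>(1 - 2 x + h c) (g - x - h c)\<close> for \<open>x = 1\<close> and \<open>x = 0\<close>.\<close>

lemma switch_eq_bit_sum:
  fixes g h :: "'b::comm_ring_1"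
  assumes "h + h = 1"
  shows "1 + of_bool c * (g - 1) = (1 - 2 + h * of_bool c) * (g - 1 - h * of_bool c) + (1 + h * of_bool c) * (g - h * of_bool c)"
proof (cases c)
  case True
  have "(1 - 2 + h) * (g - 1 - h) + (1 + h) * (g - h) = (h + h) * g + 1 - (h + h) - (h + h) * h + h"
    by (simp add: algebra_simps)
  then show ?thesis using True assms by simp
qed simp

text \<open>One new bit per \<open>k\<close> selects one of the two summands in
  \<open>switch_eq_bit_sum\<close>. Expanding the product over \<open>K\<close> makes these
  selections a subset \<open>X\<close> of \<open>K\<close>, and the pair of \<open>S\<close> and
  \<open>X\<close> is a subset of \<open>B <+> K\<close>.\<close>

lemma hypercube_product_switchI:
  fixes F :: "'j \<Rightarrow> 'i set \<Rightarrow> 'a::field mpoly" and G :: "'k \<Rightarrow> 'i set \<Rightarrow> 'a mpoly"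
  assumes char: "CHAR('a) \<noteq> 2" and V: "finite V" and B: "finite B" and J: "finite J" and K: "finite K"
    and F: "\<And>j. j \<in> J \<Longrightarrow> affine_in_bits V B (F j)"
    and G: "\<And>k. k \<in> K \<Longrightarrow> affine_in_bits V B (G k)"
  shows "hypercube_product V (card B + card K) (card J + 2 * card K)
    (\<Sum>S\<in>Pow B. (\<Prod>j\<in>J. F j S) * (\<Prod>k\<in>K. 1 + of_bool (s k \<in> S) * (G k S - 1)))"
proof -
  \<comment> \<open>The characteristic of a field is not 1, so \<open>2 = 0\<close> would force it
    to be 2.\<close>
  have "(2 :: 'a) \<noteq> 0"
  proof
    assume "(2 :: 'a) = 0"
    then have "CHAR('a) dvd 2"
      using of_nat_eq_0_iff_char_dvd[where ?'a = 'a, of 2] by simp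
    then have "CHAR('a) = 1 \<or> CHAR('a) = 2"
      using two_is_prime_nat prime_nat_iff by blast
    then show False
      using char by simp
  qed
  then have half: "Const (1 / 2) + Const (1 / 2) = (1 :: 'a mpoly)"
    by (simp flip: Const_add)
  define h where "h = (Const (1 / 2) :: 'a mpoly)"
  \<comment> \<open>The two affine factors for the new bit \<open>x\<close>; their product, summed
    over \<open>x\<close>, is the factor \<open>1 + c (l - 1)\<close> with \<open>c\<close> the bit
    \<open>s k \<in> S\<close> and \<open>l\<close> the form \<open>G k S\<close>.\<close>
  define M1 where "M1 k S x = 1 - of_bool x - of_bool x + h * of_bool (s k \<in> S)" for k x S
  define M2 where "M2 k S x = G k S - of_bool x - h * of_bool (s k \<in> S)" for k x S
  define L where "L = case_sum (\<lambda>j S. F j (Inl -` S))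
    (case_sum (\<lambda>k S. M1 k (Inl -` S) (Inr k \<in> S)) (\<lambda>k S. M2 k (Inl -` S) (Inr k \<in> S)))"
  have lin: "affine_in_bits V (B <+> K) (L j)" if "j \<in> J <+> K <+> K" for j
  proof -
    have fin: "finite (B <+> K)" using B K by simp
    have mem: "affine_in_bits V (B <+> K) (\<lambda>S. of_bool (s k \<in> Inl -` S))" for k
      by (rule affine_in_bits_Inl_vimage[OF affine_in_bits_mem[OF B] B K])
    have M: "affine_in_bits V (B <+> K) (\<lambda>S. M1 k (Inl -` S) (Inr k \<in> S))"
      "affine_in_bits V (B <+> K) (\<lambda>S. M2 k (Inl -` S) (Inr k \<in> S))" if "k \<in> K" for k
      unfolding M1_def M2_def h_def
      by (intro affine_in_bits_intros fin mem affine_in_bits_Inl_vimage[OF G[OF that] B K])+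
    show ?thesis
      using that
    proof (elim PlusE)
      fix i assume "i \<in> J" "j = Inl i"
      then show ?thesis
        using affine_in_bits_Inl_vimage[OF F B K, of i] by (simp add: L_def)
    qed (auto simp: L_def M)
  qed
  have expand: "(\<Prod>k\<in>K. 1 + of_bool (s k \<in> S) * (G k S - 1))
      = (\<Sum>X\<in>Pow K. \<Prod>k\<in>K. M1 k S (k \<in> X) * M2 k S (k \<in> X))" for S
  proof -
    have "(\<Prod>k\<in>K. 1 + of_bool (s k \<in> S) * (G k S - 1))
        = (\<Prod>k\<in>K. M1 k S True * M2 k S True + M1 k S False * M2 k S False)"
    proof (rule prod.cong)
      fix k
      show "1 + of_bool (s k \<in> S) * (G k S - 1) = M1 k S True * M2 k S True + M1 k S False * M2 k S False"
        using switch_eq_bit_sum[of h "s k \<in> S" "G k S"] half by (simp add: M1_def M2_def h_def)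
    qed simp
    also have "\<dots> = (\<Sum>X\<in>Pow K. (\<Prod>k\<in>X. M1 k S True * M2 k S True) * (\<Prod>k\<in>K - X. M1 k S False * M2 k S False))"
      by (rule prod_add[OF K])
    also have "\<dots> = (\<Sum>X\<in>Pow K. \<Prod>k\<in>K. M1 k S (k \<in> X) * M2 k S (k \<in> X))"
    proof (rule sum.cong)
      fix X assume "X \<in> Pow K"
      then have "(\<Prod>k\<in>K. M1 k S (k \<in> X) * M2 k S (k \<in> X))
          = (\<Prod>k\<in>K - X. M1 k S (k \<in> X) * M2 k S (k \<in> X)) * (\<Prod>k\<in>X. M1 k S (k \<in> X) * M2 k S (k \<in> X))"
        using K by (intro prod.subset_diff) auto
      then show "(\<Prod>k\<in>X. M1 k S True * M2 k S True) * (\<Prod>k\<in>K - X. M1 k S False * M2 k S False)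
          = (\<Prod>k\<in>K. M1 k S (k \<in> X) * M2 k S (k \<in> X))"
        by (simp add: mult.commute)
    qed simp
    finally show ?thesis .
  qed
  have "hypercube_product V (card (B <+> K)) (card (J <+> K <+> K)) (\<Sum>S\<in>Pow (B <+> K). \<Prod>j\<in>J <+> K <+> K. L j S)"
    using V B J K lin by (intro hypercube_productI) auto
  also have "(\<Sum>S\<in>Pow (B <+> K). \<Prod>j\<in>J <+> K <+> K. L j S)
      = (\<Sum>(S, X)\<in>Pow B \<times> Pow K. (\<Prod>j\<in>J. F j S) * (\<Prod>k\<in>K. M1 k S (k \<in> X) * M2 k S (k \<in> X)))"
  proof (rule sum.reindex_bij_witness[of _ "\<lambda>(S, X). S <+> X" "\<lambda>S. (Inl -` S, Inr -` S)"])
    fix S assume "S \<in> Pow (B <+> K)"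
    show "(case (Inl -` S, Inr -` S) of (S, X) \<Rightarrow> S <+> X) = S"
      by (simp add: Inl_vimage_Plus_Inr_vimage)
    show "(case (Inl -` S, Inr -` S) of (S, X) \<Rightarrow> (\<Prod>j\<in>J. F j S) * (\<Prod>k\<in>K. M1 k S (k \<in> X) * M2 k S (k \<in> X)))
        = (\<Prod>j\<in>J <+> K <+> K. L j S)"
      using J K by (simp add: prod.Plus L_def prod.distrib)
  qed auto
  also have "\<dots> = (\<Sum>S\<in>Pow B. (\<Prod>j\<in>J. F j S) * (\<Prod>k\<in>K. 1 + of_bool (s k \<in> S) * (G k S - 1)))"
    by (simp add: expand sum_distrib_left flip: sum.cartesian_product)
  finally show ?thesis
    using B J K by (simp add: card_Plus mult_2)
qed

text \<open>The original bits are the rules. \<open>sum_derivations\<close> supplies the sum and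
  \<open>exactly_indicator\<close> the test at each node; each weight and each pair of rival rules
  at a node costs one more bit.\<close>

lemma hypercube_product_derivations:
  fixes H :: "'n \<Rightarrow> 'a::field mpoly" and w :: "'n \<Rightarrow> 't::linorder \<Rightarrow> 'a mpoly" and ch :: "'n \<Rightarrow> 't \<Rightarrow> 'n set"
    and I :: "'n \<Rightarrow> 'p set" and rank :: "'n \<Rightarrow> nat"
  assumes char: "CHAR('a) \<noteq> 2" and V: "finite V"
    and T: "finite T" "T \<noteq> {}" and U: "finite U"
    and ch: "\<And>u t. u \<in> U \<Longrightarrow> t \<in> T \<Longrightarrow> ch u t \<subseteq> U"
    and rank: "\<And>u t c. u \<in> U \<Longrightarrow> t \<in> T \<Longrightarrow> c \<in> ch u t \<Longrightarrow> rank c < rank u"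
    and I_sub: "\<And>u t c. u \<in> U \<Longrightarrow> t \<in> T \<Longrightarrow> c \<in> ch u t \<Longrightarrow> I c \<subseteq> I u"
    and I_ne: "\<And>u t c. u \<in> U \<Longrightarrow> t \<in> T \<Longrightarrow> c \<in> ch u t \<Longrightarrow> I c \<noteq> {}"
    and I_disj: "\<And>u t. u \<in> U \<Longrightarrow> t \<in> T \<Longrightarrow> disjoint_family_on I (ch u t)"
    and w: "\<And>u t. u \<in> U \<Longrightarrow> t \<in> T \<Longrightarrow> affine_in_bits V (U \<times> T) (\<lambda>_. w u t)"
    and H: "\<And>u. u \<in> U \<Longrightarrow> H u = (\<Sum>t\<in>T. w u t * (\<Prod>c\<in>ch u t. H c))"
    and u0: "u0 \<in> U"
  shows "\<exists>P\<le>3 * (card U * card T ^ 2). \<exists>Q\<le>6 * (card U * card T ^ 2). hypercube_product V P Q (H u0)"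
proof -
  define R where "R = {(t, t'). t \<in> T \<and> t' \<in> T \<and> t < t'}"
  have R: "finite R" "card R \<le> card T ^ 2"
  proof -
    have "R \<subseteq> T \<times> T" by (auto simp: R_def)
    then show "finite R" "card R \<le> card T ^ 2"
      using T card_mono[of "T \<times> T" R] finite_subset[of R "T \<times> T"]
      by (auto simp: card_cartesian_product power2_eq_square)
  qed
  define used where "used E u = (\<Sum>t\<in>T. of_bool ((u, t) \<in> E) :: 'a mpoly)" for E :: "('n \<times> 't) set" and u
  define act where "act E u = of_bool (u \<in> {u0}) + (\<Sum>(v, t)\<in>E. of_bool (u \<in> ch v t) :: 'a mpoly)" for E u
  define excl where "excl A = (\<Prod>(t, t')\<in>R. 1 + of_bool (t \<in> A) * (1 - of_bool (t' \<in> A) - 1) :: 'a mpoly)" for A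
  define \<psi> where "\<psi> A b = (1 - (\<Sum>t\<in>T. of_bool (t \<in> A)) + b) * (1 + (\<Sum>t\<in>T. of_bool (t \<in> A)) - b) * excl A" for A b
  have \<psi>: "\<psi> A 0 = of_bool (A = {})" "\<psi> A 1 = of_bool (\<exists>t. A = {t})" if "A \<subseteq> T" for A
    unfolding \<psi>_def excl_def R_def by (rule exactly_indicator[OF T(1) that])+
  have "(\<Prod>u\<in>{u0}. H u) = (\<Sum>E\<in>Pow (U \<times> T). (\<Prod>u\<in>U. \<psi> {t. (u, t) \<in> E} (act E u)) * (\<Prod>(v, t)\<in>E. w v t))"
    unfolding act_def
    by (rule sum_derivations[where I = I and rank = rank and ch = ch and w = w, symmetric, OF T(1) \<psi> U])
      (use ch rank I_sub I_ne I_disj H u0 in \<open>simp_all add: disjoint_family_on_def\<close>)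
  then have Hu0: "H u0 = (\<Sum>E\<in>Pow (U \<times> T). (\<Prod>u\<in>U. \<psi> {t. (u, t) \<in> E} (act E u)) * (\<Prod>(v, t)\<in>E. w v t))"
    by simp
  \<comment> \<open>\<open>F\<close> holds the two affine factors of the test at each node.
    \<open>G\<close> and \<open>s\<close> describe the switches: a chosen rule contributes its
    weight, and a chosen \<open>(u, t)\<close> contributes a factor that vanishes if
    \<open>(u, t')\<close> is chosen as well.\<close>
  define F where "F = case_sum (\<lambda>u E. 1 - used E u + act E u) (\<lambda>u E. 1 + used E u - act E u)"
  define G where "G = case_sum (\<lambda>(u, t) E. w u t) (\<lambda>(u, t :: 't, t') (E :: ('n \<times> 't) set). 1 - of_bool ((u, t') \<in> E))"
  define s where "s = case_sum (\<lambda>p. p) (\<lambda>(u, t, t' :: 't). (u, t) :: 'n \<times> 't)"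
  let ?K = "(U \<times> T) <+> (U \<times> R)"
  have fin: "finite (U \<times> T)"
    using U T by simp
  have lin_used: "affine_in_bits V (U \<times> T) (\<lambda>E. used E u)" for u
    unfolding used_def by (intro affine_in_bits_intros fin)
  have lin_act: "affine_in_bits V (U \<times> T) (\<lambda>E. act E u)" for u
  proof (rule affine_in_bitsI[where c = "of_bool (u \<in> {u0})" and a = "\<lambda>_. 0" and \<beta> = "\<lambda>(v, t). of_bool (u \<in> ch v t)"])
    fix E
    have C: "Const (of_bool b) = (of_bool b :: 'a mpoly)" for b
      by (cases b) simp_all
    show "act E u = Const (of_bool (u \<in> {u0})) + (\<Sum>i\<in>V. Const 0 * Var i)
        + (\<Sum>i\<in>E. Const (case i of (v, t) \<Rightarrow> of_bool (u \<in> ch v t)))"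
      by (simp add: act_def C case_prod_unfold del: sum_of_bool_eq)
  qed
  have "hypercube_product V (card (U \<times> T) + card ?K) (card (U <+> U) + 2 * card ?K)
    (\<Sum>E\<in>Pow (U \<times> T). (\<Prod>j\<in>U <+> U. F j E) * (\<Prod>k\<in>?K. 1 + of_bool (s k \<in> E) * (G k E - 1)))"
  proof (rule hypercube_product_switchI[OF char V fin])
    show "affine_in_bits V (U \<times> T) (F j)" if "j \<in> U <+> U" for j
      using that unfolding F_def
      by (elim PlusE) (simp, intro affine_in_bits_intros lin_used lin_act)+
    show "affine_in_bits V (U \<times> T) (G k)" if "k \<in> ?K" for k
      using that unfolding G_def
      by (elim PlusE) (auto intro!: w affine_in_bits_diff affine_in_bits_1 affine_in_bits_mem fin)
  qed (use U T R in auto)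
  also have "(\<Sum>E\<in>Pow (U \<times> T). (\<Prod>j\<in>U <+> U. F j E) * (\<Prod>k\<in>?K. 1 + of_bool (s k \<in> E) * (G k E - 1))) = H u0"
    unfolding Hu0
  proof (rule sum.cong)
    fix E assume "E \<in> Pow (U \<times> T)"
    then have E: "E \<subseteq> U \<times> T" by simp
    \<comment> \<open>Switches of rules outside \<open>E\<close> equal 1, so the product of weights
      may run over all rules.\<close>
    have "(\<Prod>(v, t)\<in>E. w v t) = (\<Prod>(v, t)\<in>U \<times> T. 1 + of_bool ((v, t) \<in> E) * (w v t - 1))"
      using E fin by (intro prod.mono_neutral_cong_left) auto
    moreover have "(\<Prod>(u, t, t')\<in>U \<times> R. 1 + of_bool ((u, t) \<in> E) * (1 - of_bool ((u, t') \<in> E) - 1))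
        = (\<Prod>u\<in>U. excl {t. (u, t) \<in> E})"
      by (simp add: excl_def prod.cartesian_product case_prod_unfold)
    ultimately show "(\<Prod>j\<in>U <+> U. F j E) * (\<Prod>k\<in>?K. 1 + of_bool (s k \<in> E) * (G k E - 1))
      = (\<Prod>u\<in>U. \<psi> {t. (u, t) \<in> E} (act E u)) * (\<Prod>(v, t)\<in>E. w v t)"
      using U T R
      by (simp add: prod.Plus F_def G_def s_def \<psi>_def used_def prod.distrib case_prod_unfold mult_ac
          del: sum_of_bool_eq)
  qed simp
  finally have "hypercube_product V (card (U \<times> T) + card ?K) (card (U <+> U) + 2 * card ?K) (H u0)" .
  moreover have "card (U \<times> T) + card ?K \<le> 3 * (card U * card T ^ 2)"
    "card (U <+> U) + 2 * card ?K \<le> 6 * (card U * card T ^ 2)"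
  proof -
    \<comment> \<open>Nodes, rules, and rival pairs over all nodes each number at most
      \<open>card U * card T ^ 2\<close>. The bits make up three such terms, the factors
      six.\<close>
    have "1 \<le> card T"
      using T by (simp add: Suc_le_eq card_gt_0_iff)
    then have "card T \<le> card T ^ 2" "1 \<le> card T ^ 2"
      by (auto simp: power2_eq_square)
    then have "card U * card T \<le> card U * card T ^ 2" "card U \<le> card U * card T ^ 2"
      "card U * card R \<le> card U * card T ^ 2"
      using R(2) by auto
    moreover have "card ?K = card U * card T + card U * card R" "card (U <+> U) = card U + card U"
      "card (U \<times> T) = card U * card T"
      using U T(1) R(1) by (simp_all add: card_Plus card_cartesian_product)
    ultimately show "card (U \<times> T) + card ?K \<le> 3 * (card U * card T ^ 2)"
      "card (U <+> U) + 2 * card ?K \<le> 6 * (card U * card T ^ 2)"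
      by linarith+
  qed
  ultimately show ?thesis by blast
qed

section \<open>Circuits as weighted grammars\<close>

lemma gate_values_snoc: "gate_values (C @ [g]) = gate_values C @ [gate_value (gate_values C) g]"
  by (simp add: gate_values_def)

lemma length_gate_values [simp]: "length (gate_values C) = length C"
  by (induction C rule: rev_induct) (simp_all add: gate_values_snoc, simp add: gate_values_def)

lemma gate_value_append: "gate_ok (length vs) g \<Longrightarrow> gate_value (vs @ ws) g = gate_value vs g"
  by (cases g) (simp_all add: nth_append)

text \<open>A gate refers only to earlier positions, whose values stay fixed as the list grows; the
  final list can thus replace the prefix.\<close>

lemma gate_values_nth:
  assumes "\<forall>k<length C. gate_ok k (C ! k)" "k < length C"
  shows "gate_values C ! k = gate_value (gate_values C) (C ! k)"
  using assms
proof (induction C rule: rev_induct)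
  case (snoc g C)
  show ?case
  proof (cases "k = length C")
    case True
    then show ?thesis
      using snoc.prems(1)[rule_format, of k] by (simp add: gate_values_snoc nth_append gate_value_append)
  next
    case False
    then have k: "k < length C"
      using snoc.prems by simp
    have ok: "gate_ok i (C ! i)" if "i < length C" for i
      using snoc.prems(1)[rule_format, of i] that by (simp add: nth_append)
    have "gate_value (gate_values C @ ws) (C ! k) = gate_value (gate_values C) (C ! k)" for ws
      using ok[OF k] k by (cases "C ! k") (simp_all add: nth_append)
    then show ?thesis
      using snoc.IH ok k by (simp add: gate_values_snoc nth_append)
  qed
qed simp

text \<open>The node \<open>(v, l, r)\<close> stands for the component of degree \<open>r - l\<close> of gate \<open>v\<close>, producing the leaves at
  positions \<open>l, \<dots>, r - 1\<close>. The start symbol \<open>(length C, 0, d)\<close> is not a gate; it stands for the whole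
  polynomial and is replaced by a component of the output gate. Unused rule indices get weight 0.\<close>

type_synonym node = "nat \<times> nat \<times> nat"

definition nodes :: "'a gate list \<Rightarrow> nat \<Rightarrow> node set" where
  "nodes C d = insert (length C, 0, d) {(v, l, r). v < length C \<and> l < r \<and> r \<le> d}"

text \<open>At a product gate, rule \<open>t\<close> gives degree \<open>t\<close> to the first
  factor, which takes the left \<open>t\<close> positions; the positions keep the two children
  distinct even if \<open>i = j\<close>. For \<open>t = 0\<close> and \<open>t = r - l\<close> one
  factor has degree 0 and appears in \<open>node_weight\<close> instead.\<close>

fun node_children :: "'a gate list \<Rightarrow> node \<Rightarrow> nat \<Rightarrow> node set" where
  "node_children C (v, l, r) t =
    (if v = length C then (if t = 0 then {} else {(v - 1, 0, t)})
     else case C ! v of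
       Add i j \<Rightarrow> if t = 0 then {(i, l, r)} else if t = 1 then {(j, l, r)} else {}
     | Mult i j \<Rightarrow> if t = 0 then {(j, l, r)} else if t < r - l then {(i, l, l + t), (j, l + t, r)}
         else if t = r - l then {(i, l, r)} else {}
     | _ \<Rightarrow> {})"

fun node_weight :: "'a::comm_ring_1 gate list \<Rightarrow> node \<Rightarrow> nat \<Rightarrow> 'a mpoly" where
  "node_weight C (v, l, r) t =
    (if v = length C then (if t = 0 then hom_comp 0 (circuit_value C) else 1)
     else case C ! v of
       Input x \<Rightarrow> if t = 0 \<and> r - l = 1 then Var x else 0
     | Scalar c \<Rightarrow> 0
     | Add i j \<Rightarrow> if t \<le> 1 then 1 else 0
     | Mult i j \<Rightarrow> if t = 0 then hom_comp 0 (gate_values C ! i) else if t < r - l then 1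
         else if t = r - l then hom_comp 0 (gate_values C ! j) else 0)"

fun node_poly :: "'a::comm_ring_1 gate list \<Rightarrow> node \<Rightarrow> 'a mpoly" where
  "node_poly C (v, l, r) = (if v = length C then circuit_value C else hom_comp (r - l) (gate_values C ! v))"

fun node_interval :: "node \<Rightarrow> nat set" where
  "node_interval (v, l, r) = {l..<r}"

lemma circuit_value_eq_nth:
  assumes "is_circuit C"
  shows "circuit_value C = gate_values C ! (length C - 1)"
proof -
  have "gate_values C \<noteq> []"
    using assms unfolding is_circuit_def by (metis length_gate_values length_0_conv)
  then show ?thesis
    by (simp add: circuit_value_def last_conv_nth)
qed

text \<open>Homogeneous components add over sums and convolve over products. This is the recursion
  required of \<open>H\<close> in \<open>sum_derivations\<close>; the degree bound ensures that the
  start symbol covers all components.\<close>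

lemma node_poly_eq:
  fixes C :: "'a::comm_ring_1 gate list"
  assumes C: "is_circuit C" and d: "total_degree (circuit_value C) \<le> d" and u: "u \<in> nodes C d"
  shows "node_poly C u = (\<Sum>t\<le>d. node_weight C u t * (\<Prod>c\<in>node_children C u t. node_poly C c))"
proof -
  obtain v l r where u_eq: "u = (v, l, r)"
    by (cases u) auto
  have len: "length C > 0"
    using C by (simp add: is_circuit_def)
  show ?thesis
  proof (cases "v = length C")
    case True
    \<comment> \<open>Lets \<open>node_poly\<close> treat the output gate as a gate and not as the
      start symbol.\<close>
    have "length C - Suc 0 \<noteq> length C"
      using len by linarith
    have "circuit_value C = (\<Sum>t\<le>d. hom_comp t (circuit_value C))"
      by (rule sum_hom_comp[OF d, symmetric])
    also have "\<dots> = (\<Sum>t\<le>d. node_weight C u t * (\<Prod>c\<in>node_children C u t. node_poly C c))"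
      using True \<open>length C - Suc 0 \<noteq> length C\<close> by (intro sum.cong) (auto simp: u_eq circuit_value_eq_nth[OF C])
    finally show ?thesis using True by (simp add: u_eq)
  next
    case False
    then have v: "v < length C" "l < r" "r \<le> d"
      using u by (auto simp: nodes_def u_eq)
    have ok: "gate_ok v (C ! v)"
      using C v by (simp add: is_circuit_def)
    have val: "gate_values C ! v = gate_value (gate_values C) (C ! v)"
      using C v by (intro gate_values_nth) (simp_all add: is_circuit_def)
    show ?thesis
    proof (cases "C ! v")
      case (Input x)
      have "(\<Sum>t\<le>d. node_weight C u t * (\<Prod>c\<in>node_children C u t. node_poly C c))
          = (\<Sum>t\<le>d. if t = 0 then if r - l = 1 then Var x else 0 else 0)"
        using Input False by (intro sum.cong) (auto simp: u_eq)
      then show ?thesis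
        using Input False val by (simp add: u_eq hom_comp_Var)
    next
      case (Scalar c)
      then show ?thesis
        using False val v by (simp add: u_eq hom_comp_Const)
    next
      case (Add i j)
      \<comment> \<open>Both rules are available, since \<open>l < r\<close> and
        \<open>r \<le> d\<close> give \<open>1 \<le> d\<close>.\<close>
      have "(\<Sum>t\<le>d. node_weight C u t * (\<Prod>c\<in>node_children C u t. node_poly C c))
          = (\<Sum>t\<in>{0, 1}. node_weight C u t * (\<Prod>c\<in>node_children C u t. node_poly C c))"
        using Add False v by (intro sum.mono_neutral_right) (auto simp: u_eq)
      also have "\<dots> = node_poly C u"
        using Add False val ok v by (simp add: u_eq hom_comp_add)
      finally show ?thesis ..
    next
      case (Mult i j)
      \<comment> \<open>Rules beyond \<open>r - l\<close> have weight 0, and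
        \<open>r \<le> d\<close> makes all the others available.\<close>
      have "(\<Sum>t\<le>d. node_weight C u t * (\<Prod>c\<in>node_children C u t. node_poly C c))
          = (\<Sum>t\<le>r - l. node_weight C u t * (\<Prod>c\<in>node_children C u t. node_poly C c))"
        using Mult False v by (intro sum.mono_neutral_right) (auto simp: u_eq)
      also have "\<dots> = (\<Sum>t\<le>r - l. hom_comp t (gate_values C ! i) * hom_comp (r - l - t) (gate_values C ! j))"
        using Mult False ok v by (intro sum.cong) (auto simp: u_eq mult.commute)
      also have "\<dots> = node_poly C u"
        using Mult False val by (simp add: u_eq hom_comp_mult)
      finally show ?thesis ..
    qed
  qed
qed

text \<open>In \<open>M\<close>, two factors \<open>d + 1\<close> count the endpoints of intervals
  and two more the pairs of rule indices; \<open>length C + 1\<close> counts the gates and the start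
  symbol.\<close>

lemma circuit_hypercube_product:
  fixes C :: "'a::field gate list"
  assumes char: "CHAR('a) \<noteq> 2" and C: "is_circuit C" and d: "total_degree (circuit_value C) \<le> d"
  defines "V \<equiv> {x. Input x \<in> set C}" and "M \<equiv> (length C + 1) * (d + 1) ^ 4"
  shows "finite V \<and> card V \<le> length C \<and>
    (\<exists>P\<le>3 * M. \<exists>Q\<le>6 * M. hypercube_product V P Q (circuit_value C))"
proof -
  have inj: "inj_on Input V" and sub: "Input ` V \<subseteq> set C"
    by (auto simp: V_def inj_on_def)
  have finV: "finite V"
    using finite_imageD[OF finite_subset[OF sub] inj] by simp
  have "card V \<le> card (set C)"
    using card_mono[OF _ sub] by (simp add: card_image[OF inj])
  also have "\<dots> \<le> length C"
    by (rule card_length)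
  finally have cardV: "card V \<le> length C" .
  have ok: "gate_ok v (C ! v)" if "v < length C" for v
    using C that by (simp add: is_circuit_def)
  have len: "length C > 0"
    using C by (simp add: is_circuit_def)
  have sub: "nodes C d \<subseteq> {..length C} \<times> {..d} \<times> {..d}"
    by (auto simp: nodes_def)
  have finU: "finite (nodes C d)"
    by (rule finite_subset[OF sub]) simp
  have "card (nodes C d) \<le> card ({..length C} \<times> {..d} \<times> {..d})"
    by (rule card_mono[OF _ sub]) simp
  also have "\<dots> = (length C + 1) * (d + 1) ^ 2"
    by (simp add: card_cartesian_product power2_eq_square)
  finally have "card (nodes C d) * (d + 1) ^ 2 \<le> (length C + 1) * (d + 1) ^ 2 * (d + 1) ^ 2"
    by (rule mult_right_mono) simp
  also have "\<dots> = M"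
    unfolding M_def by algebra
  finally have cardU: "card (nodes C d) * card {..d} ^ 2 \<le> M"
    by simp
  have "\<exists>P\<le>3 * (card (nodes C d) * card {..d} ^ 2). \<exists>Q\<le>6 * (card (nodes C d) * card {..d} ^ 2).
      hypercube_product V P Q (node_poly C (length C, 0, d))"
  proof (rule hypercube_product_derivations[where ch = "node_children C" and I = node_interval
        and rank = fst and w = "node_weight C", OF char finV _ _ finU])
    fix u t c assume u: "u \<in> nodes C d" and t: "t \<in> {..d}"
    obtain v l r where u_eq: "u = (v, l, r)"
      by (cases u) auto
    note defs = nodes_def u_eq
    show "node_children C u t \<subseteq> nodes C d"
      using u t len ok[of v] by (auto simp: defs split: gate.splits if_splits)
    show "disjoint_family_on node_interval (node_children C u t)"
      using u t by (auto simp: defs disjoint_family_on_def split: gate.splits if_splits)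
    show "fst c < fst u" "node_interval c \<subseteq> node_interval u" "node_interval c \<noteq> {}"
      if "c \<in> node_children C u t"
      using u t that len ok[of v] by (auto simp: defs split: gate.splits if_splits)
    show "affine_in_bits V (nodes C d \<times> {..d}) (\<lambda>_. node_weight C u t)"
    proof (cases "\<exists>x. v < length C \<and> C ! v = Input x")
      case True
      then obtain x where x: "v < length C" "C ! v = Input x" by blast
      then have "x \<in> V"
        unfolding V_def using nth_mem by force
      then show ?thesis
        using x by (simp add: u_eq affine_in_bits_Var finV affine_in_bits_0)
    next
      case False
      moreover have "v \<le> length C"
        using u by (auto simp: defs)
      ultimately show ?thesis
        by (auto simp: u_eq hom_comp_degree_0 affine_in_bits_Const affine_in_bits_0 affine_in_bits_1 split: gate.split)
    qed
  next
    fix u assume "u \<in> nodes C d"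
    then show "node_poly C u = (\<Sum>t\<le>d. node_weight C u t * (\<Prod>c\<in>node_children C u t. node_poly C c))"
      by (rule node_poly_eq[OF C d])
  qed (auto simp: nodes_def)
  then obtain P Q where "P \<le> 3 * (card (nodes C d) * card {..d} ^ 2)" "Q \<le> 6 * (card (nodes C d) * card {..d} ^ 2)"
    "hypercube_product V P Q (circuit_value C)"
    by auto
  moreover from this have "P \<le> 3 * M" "Q \<le> 6 * M"
    using cardU by linarith+
  ultimately show ?thesis
    using finV cardV by blast
qed

section \<open>Polynomially bounded functions\<close>

lemma poly_bounded_le: "poly_bounded t \<Longrightarrow> (\<And>n. s n \<le> t n) \<Longrightarrow> poly_bounded s"
  unfolding poly_bounded_def by (meson order_trans)

lemma poly_bounded_const: "poly_bounded (\<lambda>n. k)"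
  unfolding poly_bounded_def by (rule exI[of _ "[:k:]"]) simp

lemma poly_bounded_id: "poly_bounded (\<lambda>n. n)"
  unfolding poly_bounded_def by (rule exI[of _ "[:0, 1:]"]) simp

lemma poly_bounded_add:
  assumes "poly_bounded s" "poly_bounded t"
  shows "poly_bounded (\<lambda>n. s n + t n)"
proof -
  obtain P Q where "\<forall>n. s n \<le> poly P n" "\<forall>n. t n \<le> poly Q n"
    using assms unfolding poly_bounded_def by blast
  then show ?thesis
    unfolding poly_bounded_def by (intro exI[of _ "P + Q"]) (auto intro: add_mono)
qed

lemma poly_bounded_mult:
  assumes "poly_bounded s" "poly_bounded t"
  shows "poly_bounded (\<lambda>n. s n * t n)"
proof -
  obtain P Q where "\<forall>n. s n \<le> poly P n" "\<forall>n. t n \<le> poly Q n"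
    using assms unfolding poly_bounded_def by blast
  then show ?thesis
    unfolding poly_bounded_def by (intro exI[of _ "P * Q"]) (auto intro: mult_mono)
qed

lemma poly_bounded_power: "poly_bounded t \<Longrightarrow> poly_bounded (\<lambda>n. t n ^ k)"
  by (induction k) (simp_all add: poly_bounded_mult poly_bounded_const)

text \<open>The coefficients are natural numbers. Monotonicity is what allows bounds to be
  composed.\<close>

lemma poly_nat_mono: "x \<le> y \<Longrightarrow> poly P x \<le> poly P (y :: nat)"
  by (induction P) (auto intro: add_mono mult_mono)

lemma poly_bounded_compose:
  assumes "poly_bounded t" "poly_bounded q"
  shows "poly_bounded (\<lambda>n. t (q n))"
proof -
  obtain P Q where "\<forall>n. t n \<le> poly P n" "\<forall>n. q n \<le> poly Q n"
    using assms unfolding poly_bounded_def by blast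
  then have "t (q n) \<le> poly (pcompose P Q) n" for n
    unfolding poly_pcompose using poly_nat_mono order_trans by blast
  then show ?thesis
    unfolding poly_bounded_def by blast
qed

lemmas poly_bounded_intros = poly_bounded_const poly_bounded_id poly_bounded_add poly_bounded_mult
  poly_bounded_power

section \<open>Circuits for products of affine forms\<close>

text \<open>Gate arguments are absolute positions and must move when a circuit is placed after
  \<open>k\<close> other gates.\<close>

fun shift_gate :: "nat \<Rightarrow> 'a gate \<Rightarrow> 'a gate" where
  "shift_gate k (Add i j) = Add (k + i) (k + j)"
| "shift_gate k (Mult i j) = Mult (k + i) (k + j)"
| "shift_gate k g = g"

lemma gate_values_append_shift:
  "gate_values (C @ map (shift_gate (length C)) D) = gate_values C @ gate_values D"
proof (induction D rule: rev_induct)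
  case Nil
  then show ?case by (simp add: gate_values_def)
next
  case (snoc g D)
  have "gate_value (gate_values C @ vs) (shift_gate (length C) g) = gate_value vs g" for vs
    by (cases g) (simp_all add: nth_append)
  then show ?case
    using snoc by (simp add: gate_values_snoc flip: append_assoc)
qed

definition circuit_size_le :: "nat \<Rightarrow> 'a::comm_ring_1 mpoly \<Rightarrow> bool" where
  "circuit_size_le k f \<longleftrightarrow> (\<exists>C. is_circuit C \<and> circuit_value C = f \<and> length C \<le> k)"

lemma circuit_size_le_mono: "circuit_size_le k f \<Longrightarrow> k \<le> k' \<Longrightarrow> circuit_size_le k' f"
  unfolding circuit_size_le_def using order_trans by blast

lemma circuit_size_le_Const: "circuit_size_le 1 (Const c)"
  unfolding circuit_size_le_def
  by (rule exI[of _ "[Scalar c]"]) (simp add: is_circuit_def circuit_value_def gate_values_def)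

lemma circuit_size_le_Var: "circuit_size_le 1 (Var i)"
  unfolding circuit_size_le_def
  by (rule exI[of _ "[Input i]"]) (simp add: is_circuit_def circuit_value_def gate_values_def)

lemma circuit_size_le_combine:
  assumes f: "circuit_size_le k f" and g: "circuit_size_le m g"
  shows "circuit_size_le (k + m + 1) (f + g)" "circuit_size_le (k + m + 1) (f * g)"
proof -
  obtain C where C: "is_circuit C" "circuit_value C = f" "length C \<le> k"
    using f unfolding circuit_size_le_def by blast
  obtain D where D: "is_circuit D" "circuit_value D = g" "length D \<le> m"
    using g unfolding circuit_size_le_def by blast
  define CD where "CD = C @ map (shift_gate (length C)) D"
  have len: "0 < length C" "0 < length D" "length CD = length C + length D"
    using C D by (simp_all add: is_circuit_def CD_def)
  have ok: "gate_ok i (CD ! i)" if "i < length CD" for i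
  proof (cases "i < length C")
    case True
    then show ?thesis
      using C by (simp add: CD_def nth_append is_circuit_def)
  next
    case False
    define j where "j = i - length C"
    have j: "i = length C + j" "j < length D"
      using False that len(3) by (simp_all add: j_def)
    then have "gate_ok j (D ! j)"
      using D by (simp add: is_circuit_def)
    then show ?thesis
      using j by (cases "D ! j") (simp_all add: CD_def nth_append)
  qed
  \<comment> \<open>The positions of the two output gates in the concatenation.\<close>
  let ?i = "length C - 1" and ?j = "length C + (length D - 1)"
  have circ: "is_circuit (CD @ [h])" if "gate_ok (length CD) h" for h
    using ok that by (auto simp: is_circuit_def nth_append less_Suc_eq)
  have vals: "gate_values CD ! ?i = f" "gate_values CD ! ?j = g"
    using len C D by (simp_all add: CD_def gate_values_append_shift nth_append circuit_value_eq_nth)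
  have "circuit_value (CD @ [h]) = gate_value (gate_values CD) h" for h
    by (simp add: circuit_value_def gate_values_snoc)
  then have "circuit_value (CD @ [Add ?i ?j]) = f + g" "circuit_value (CD @ [Mult ?i ?j]) = f * g"
    using vals by simp_all
  moreover have "is_circuit (CD @ [Add ?i ?j])" "is_circuit (CD @ [Mult ?i ?j])"
  proof -
    have "?i < length CD" "?j < length CD"
      using len by linarith+
    then show "is_circuit (CD @ [Add ?i ?j])" "is_circuit (CD @ [Mult ?i ?j])"
      by (auto intro!: circ)
  qed
  moreover have "length (CD @ [h]) \<le> k + m + 1" for h
    using len C D by simp
  ultimately show "circuit_size_le (k + m + 1) (f + g)" "circuit_size_le (k + m + 1) (f * g)"
    unfolding circuit_size_le_def by blast+
qed

lemma circuit_size_le_sum: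
  assumes "\<And>i. i \<in> A \<Longrightarrow> circuit_size_le k (f i)"
  shows "circuit_size_le (card A * (k + 1) + 1) (sum f A)"
  using assms
proof (induction A rule: infinite_finite_induct)
  case (insert x A)
  have "circuit_size_le (k + (card A * (k + 1) + 1) + 1) (f x + sum f A)"
    using insert by (intro circuit_size_le_combine) auto
  then show ?case
    using insert.hyps by (simp add: algebra_simps)
qed (use circuit_size_le_Const[of 0] in simp_all)

lemma circuit_size_le_prod:
  assumes "\<And>i. i \<in> A \<Longrightarrow> circuit_size_le k (f i)"
  shows "circuit_size_le (card A * (k + 1) + 1) (prod f A)"
  using assms
proof (induction A rule: infinite_finite_induct)
  case (insert x A)
  have "circuit_size_le (k + (card A * (k + 1) + 1) + 1) (f x * prod f A)"
    using insert by (intro circuit_size_le_combine) auto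
  then show ?case
    using insert.hyps by (simp add: algebra_simps)
qed (use circuit_size_le_Const[of 1] in simp_all)

text \<open>The forms may contain variables that cancel in the product; setting these to 0 bounds the size by
  the number of variables of the product.\<close>

lemma circuit_size_le_prod_affine:
  fixes f :: "'a::comm_ring_1 mpoly"
  assumes f: "f = (\<Prod>i<L. l i)" and l: "\<And>i. i < L \<Longrightarrow> affine_form (l i)"
  shows "circuit_size_le (L * (4 * card (vars f) + 4) + 1) f"
proof -
  define \<sigma> where "\<sigma> i = (if i \<in> vars f then Var i else 0 :: 'a mpoly)" for i
  have "f = subst \<sigma> f"
    by (rule subst_Var_eq_self[symmetric]) (simp add: \<sigma>_def)
  also have "\<dots> = (\<Prod>i<L. subst \<sigma> (l i))"
    by (simp add: f subst_prod)
  finally have f_eq: "f = (\<Prod>i<L. subst \<sigma> (l i))" .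
  \<comment> \<open>Each term takes three gates and one to add it; the summands 0 and
    \<open>c\<close> and the last addition take three more.\<close>
  have "circuit_size_le (4 * card (vars f) + 3) (subst \<sigma> (l i))" if i: "i < L" for i
  proof -
    obtain c a V where V: "finite V" and l_eq: "l i = Const c + (\<Sum>j\<in>V. Const (a j) * Var j)"
      using l[OF i] unfolding affine_form_def by blast
    have "subst \<sigma> (l i) = Const c + (\<Sum>j\<in>V. Const (a j) * \<sigma> j)"
      by (simp add: l_eq subst_add subst_sum subst_mult)
    also have "(\<Sum>j\<in>V. Const (a j) * \<sigma> j) = (\<Sum>j\<in>V \<inter> vars f. Const (a j) * Var j)"
      using V by (intro sum.mono_neutral_cong_right) (auto simp: \<sigma>_def)
    finally have eq: "subst \<sigma> (l i) = Const c + (\<Sum>j\<in>V \<inter> vars f. Const (a j) * Var j)" .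
    have "circuit_size_le (1 + 1 + 1) (Const (a j) * Var j)" for j
      by (intro circuit_size_le_combine circuit_size_le_Const circuit_size_le_Var)
    then have "circuit_size_le 3 (Const (a j) * Var j)" for j
      by (rule circuit_size_le_mono) simp
    then have "circuit_size_le (card (V \<inter> vars f) * (3 + 1) + 1) (\<Sum>j\<in>V \<inter> vars f. Const (a j) * Var j)"
      by (rule circuit_size_le_sum)
    then have "circuit_size_le (1 + (card (V \<inter> vars f) * (3 + 1) + 1) + 1) (subst \<sigma> (l i))"
      unfolding eq by (intro circuit_size_le_combine circuit_size_le_Const)
    moreover have "card (V \<inter> vars f) \<le> card (vars f)"
      by (rule card_mono) auto
    ultimately show ?thesis
      by (elim circuit_size_le_mono) simp
  qed
  then have "circuit_size_le (card {..<L} * (4 * card (vars f) + 3 + 1) + 1) (\<Prod>i<L. subst \<sigma> (l i))"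
    by (intro circuit_size_le_prod) simp
  then show ?thesis
    unfolding f_eq[symmetric] by (simp add: ac_simps)
qed

section \<open>Width-1 branching programs\<close>

lemma abp_value_width_1:
  assumes "\<forall>i\<le>L. w i = 1"
  shows "abp_value L w A = (\<Prod>i<L. A i 0 0)"
proof -
  \<comment> \<open>One vertex per layer leaves a single source-sink path.\<close>
  have "(\<Pi>\<^sub>E i\<in>{..L}. {..<w i}) = (\<Pi>\<^sub>E i\<in>{..L}. {(\<lambda>i\<in>{..L}. 0) i})"
    using assms by (intro PiE_cong) auto
  also have "\<dots> = {\<lambda>i\<in>{..L}. 0}"
    by (rule PiE_singleton) (rule restrict_extensional)
  finally show ?thesis
    by (simp add: abp_value_def)
qed

text \<open>A product of \<open>L\<close> affine forms has degree at most \<open>L\<close>, and its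
  circuit size is bounded in terms of \<open>L\<close> and the number of its variables.\<close>

lemma VP1_subset_VP: "VP1 \<subseteq> (VP :: 'a::comm_ring_1 family set)"
proof
  fix f :: "'a family" assume "f \<in> VP1"
  then obtain L w A where vars: "poly_many_vars f" and size: "poly_bounded (\<lambda>n. abp_size (L n) (w n))"
    and abp: "\<And>n. is_abp (L n) (w n) (A n)" and width: "\<And>n i. i \<le> L n \<Longrightarrow> w n i \<le> 1"
    and f: "\<And>n. f n = abp_value (L n) (w n) (A n)"
    unfolding VP_width_def by blast
  have w: "w n i = 1" if "i \<le> L n" for n i
  proof -
    have "0 < w n i"
      using abp[of n] that unfolding is_abp_def by blast
    then show ?thesis
      using width[OF that] by simp
  qed
  \<comment> \<open>The size of a width-1 program is its number of layers,
    \<open>L n + 1\<close>.\<close>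
  have L: "poly_bounded L"
    using size by (rule poly_bounded_le) (simp add: abp_size_def w)
  have f_prod: "f n = (\<Prod>i<L n. A n i 0 0)" for n
    using w by (simp add: f abp_value_width_1)
  have aff: "affine_form (A n i 0 0)" if "i < L n" for n i
    using abp[of n] that w[of i n] w[of "Suc i" n] unfolding is_abp_def by simp
  have deg: "total_degree (f n) \<le> L n" for n
  proof -
    have "total_degree (\<Prod>i<L n. A n i 0 0) \<le> card {..<L n}"
      by (rule total_degree_prod_le) (simp add: aff total_degree_affine_form[unfolded One_nat_def])
    then show ?thesis
      by (simp add: f_prod)
  qed
  have "circuit_size_le (L n * (4 * card (vars (f n)) + 4) + 1) (f n)" for n
    using f_prod aff by (rule circuit_size_le_prod_affine)
  then obtain C where C: "\<And>n. is_circuit (C n)" "\<And>n. circuit_value (C n) = f n"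
    and len: "\<And>n. length (C n) \<le> L n * (4 * card (vars (f n)) + 4) + 1"
    unfolding circuit_size_le_def by metis
  have "poly_bounded (\<lambda>n. L n * (4 * card (vars (f n)) + 4) + 1)"
    using vars L unfolding poly_many_vars_def by (intro poly_bounded_intros)
  then have "poly_bounded (\<lambda>n. length (C n))"
    using len by (rule poly_bounded_le)
  then show "f \<in> VP"
    unfolding VP_def using vars poly_bounded_le[OF L deg] C by auto
qed

lemma N_mono: "A \<subseteq> B \<Longrightarrow> N A \<subseteq> N B"
  unfolding N_def by blast

section \<open>Families\<close>

text \<open>The explicit representation from the theorem, named to serve as the third member of a
  cycle of inclusions with \<open>VNP1\<close> and \<open>VNP\<close>.\<close>

definition hypercube_product_family :: "'a::comm_ring_1 family \<Rightarrow> bool" where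
  "hypercube_product_family f \<longleftrightarrow>
       (\<exists>p q. \<exists>l :: nat \<Rightarrow> nat \<Rightarrow> 'a mpoly.
          poly_bounded p \<and> poly_bounded q \<and>
          poly_bounded (\<lambda>n. card (\<Union>i<q n. vars (l n i))) \<and>
          (\<forall>n. \<forall>i<q n. affine_form (l n i)) \<and>
          (\<forall>n. f n = (\<Sum>b\<in>bits (p n). \<Prod>i<q n. plug (p n) b (l n i))))"

lemma hypercube_product_family_in_VNP1:
  fixes f :: "'a::comm_ring_1 family"
  assumes "hypercube_product_family f"
  shows "f \<in> VNP1"
proof -
  obtain p q and l :: "nat \<Rightarrow> nat \<Rightarrow> 'a mpoly" where p: "poly_bounded p" and q: "poly_bounded q"
    and vars_l: "poly_bounded (\<lambda>n. card (\<Union>i<q n. vars (l n i)))"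
    and l: "\<And>n i. i < q n \<Longrightarrow> affine_form (l n i)"
    and f: "\<And>n. f n = (\<Sum>b\<in>bits (p n). \<Prod>i<q n. plug (p n) b (l n i))"
    using assms unfolding hypercube_product_family_def by blast
  define g where "g n = (\<Prod>i<q n. l n i)" for n
  have "card (vars (g n)) \<le> card (\<Union>i<q n. vars (l n i))" for n
    unfolding g_def by (intro card_mono vars_prod) auto
  then have "poly_many_vars g"
    unfolding poly_many_vars_def by (rule poly_bounded_le[OF vars_l])
  moreover have "poly_bounded (\<lambda>n. abp_size (q n) (\<lambda>_. 1))"
    by (rule poly_bounded_le[OF poly_bounded_add[OF q poly_bounded_const[of 1]]]) (simp add: abp_size_def)
  moreover have "is_abp (q n) (\<lambda>_. 1) (\<lambda>i u v. l n i)" for n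
    using l by (simp add: is_abp_def)
  moreover have "g n = abp_value (q n) (\<lambda>_. 1) (\<lambda>i u v. l n i)" for n
    by (simp add: g_def abp_value_width_1)
  ultimately have "g \<in> VP1"
    unfolding VP_width_def
    by (intro CollectI conjI exI[of _ q] exI[of _ "\<lambda>_ _. 1"] exI[of _ "\<lambda>n i u v. l n i"]) auto
  moreover have "f n = (\<Sum>b\<in>bits (p n). plug (p n) b (g n))" for n
    by (simp add: f g_def plug_prod)
  \<comment> \<open>\<open>g\<close> is built for the index \<open>n\<close> itself, so the
    reindexing is the identity.\<close>
  ultimately show ?thesis
    unfolding VNP1_def N_def using p poly_bounded_id by blast
qed

text \<open>The inner substitution consumes the first \<open>P\<close> variables and shifts the rest
  down, so the outer one meets the next \<open>p\<close>. Hence the inner bits come first in the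
  merged vector.\<close>

lemma plug_plug:
  "plug p b (plug P b' h) = plug (P + p) (\<lambda>i\<in>{..<P + p}. if i < P then b' i else b (i - P)) h"
proof -
  have "(\<lambda>i. plug p b (if i < P then Const (b' i) else Var (i - P)))
      = (\<lambda>i. if i < P + p then Const ((\<lambda>i\<in>{..<P + p}. if i < P then b' i else b (i - P)) i) else Var (i - (P + p)))"
    by (rule ext) (auto simp: plug_Var)
  then show ?thesis
    by (simp add: plug_def subst_subst)
qed

text \<open>A bit vector is cut after position \<open>P\<close>, in the order that
  \<open>plug_plug\<close> produces.\<close>

lemma sum_bits_add:
  fixes F :: "(nat \<Rightarrow> 'a::comm_ring_1) \<Rightarrow> 'b::comm_monoid_add"
  shows "(\<Sum>c\<in>bits (P + p). F c) = (\<Sum>b\<in>bits p. \<Sum>b'\<in>bits P. F (\<lambda>i\<in>{..<P + p}. if i < P then b' i else b (i - P)))"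
proof -
  have "(\<Sum>c\<in>bits (P + p). F c)
      = (\<Sum>(b, b')\<in>bits p \<times> bits P. F (\<lambda>i\<in>{..<P + p}. if i < P then b' i else b (i - P)))"
  proof (rule sum.reindex_bij_witness[of _ "\<lambda>(b, b'). \<lambda>i\<in>{..<P + p}. if i < P then b' i else b (i - P)"
        "\<lambda>c. (\<lambda>i\<in>{..<p}. c (P + i), \<lambda>i\<in>{..<P}. c i)"])
    fix c :: "nat \<Rightarrow> 'a" assume c: "c \<in> bits (P + p)"
    show eq: "(case (\<lambda>i\<in>{..<p}. c (P + i), \<lambda>i\<in>{..<P}. c i) of (b, b') \<Rightarrow>
        \<lambda>i\<in>{..<P + p}. if i < P then b' i else b (i - P)) = c"
      using c by (auto simp: bits_def PiE_iff extensional_def)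
    show "(\<lambda>i\<in>{..<p}. c (P + i), \<lambda>i\<in>{..<P}. c i) \<in> bits p \<times> bits P"
      using c by (auto simp: bits_def PiE_iff)
    show "(case (\<lambda>i\<in>{..<p}. c (P + i), \<lambda>i\<in>{..<P}. c i) of (b, b') \<Rightarrow>
        F (\<lambda>i\<in>{..<P + p}. if i < P then b' i else b (i - P))) = F c"
      using eq by simp
  next
    fix d :: "(nat \<Rightarrow> 'a) \<times> (nat \<Rightarrow> 'a)" assume "d \<in> bits p \<times> bits P"
    then obtain b b' where d: "d = (b, b')" "b \<in> bits p" "b' \<in> bits P"
      by auto
    let ?c = "\<lambda>i\<in>{..<P + p}. if i < P then b' i else b (i - P)"
    show "(case d of (b, b') \<Rightarrow> \<lambda>i\<in>{..<P + p}. if i < P then b' i else b (i - P)) \<in> bits (P + p)"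
      using d by (auto simp: bits_def PiE_iff)
    have "(\<lambda>i\<in>{..<p}. ?c (P + i)) = b" "(\<lambda>i\<in>{..<P}. ?c i) = b'"
      using d by (auto simp: bits_def PiE_iff extensional_def)
    then show "((\<lambda>i\<in>{..<p}. (case d of (b, b') \<Rightarrow> \<lambda>i\<in>{..<P + p}. if i < P then b' i else b (i - P)) (P + i)),
        (\<lambda>i\<in>{..<P}. (case d of (b, b') \<Rightarrow> \<lambda>i\<in>{..<P + p}. if i < P then b' i else b (i - P)) i)) = d"
      using d by simp
  qed
  then show ?thesis
    by (simp add: sum.cartesian_product)
qed

text \<open>Each polynomial of the family in \<open>VP\<close> is itself a hypercube sum of
  products, and the sum defining \<open>f\<close> merges with it into one sum over
  \<open>P (q n) + p n\<close> bits.\<close>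

lemma VNP_imp_hypercube_product_family:
  fixes f :: "'a::field family"
  assumes char: "CHAR('a) \<noteq> 2" and "f \<in> VNP"
  shows "hypercube_product_family f"
proof -
  obtain g p q where g: "g \<in> VP" and p: "poly_bounded p" and q: "poly_bounded q"
    and f: "\<And>n. f n = (\<Sum>b\<in>bits (p n). plug (p n) b (g (q n)))"
    using assms(2) unfolding VNP_def N_def by blast
  obtain C where deg: "poly_bounded (\<lambda>n. total_degree (g n))" and len: "poly_bounded (\<lambda>n. length (C n))"
    and C: "\<And>n. is_circuit (C n)" "\<And>n. g n = circuit_value (C n)"
    using g unfolding VP_def by blast
  define M where "M n = (length (C n) + 1) * (total_degree (g n) + 1) ^ 4" for n
  have M: "poly_bounded M"
    unfolding M_def by (intro poly_bounded_intros len deg)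
  have "\<exists>V P Q. finite V \<and> card V \<le> length (C n) \<and> P \<le> 3 * M n \<and> Q \<le> 6 * M n \<and> hypercube_product V P Q (g n)" for n
    using circuit_hypercube_product[OF char C(1)[of n], of "total_degree (g n)"] C(2)[of n]
    unfolding M_def by auto
  then obtain V P Q where V: "\<And>n. finite (V n)" "\<And>n. card (V n) \<le> length (C n)"
    and P: "\<And>n. P n \<le> 3 * M n" and Q: "\<And>n. Q n \<le> 6 * M n"
    and rep: "\<And>n. hypercube_product (V n) (P n) (Q n) (g n)"
    by metis
  obtain l where l: "\<And>n i. i < Q n \<Longrightarrow> affine_form (l n i) \<and> vars (l n i) \<subseteq> {..<P n} \<union> (+) (P n) ` V n"
    and g_eq: "\<And>n. g n = (\<Sum>b\<in>bits (P n). \<Prod>i<Q n. plug (P n) b (l n i))"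
    using rep unfolding hypercube_product_def by metis
  have Pb: "poly_bounded P" and Qb: "poly_bounded Q"
    by (rule poly_bounded_le[OF poly_bounded_mult[OF poly_bounded_const M]], rule P Q)+
  have vars_le: "card (\<Union>i<Q n. vars (l n i)) \<le> P n + length (C n)" for n
  proof -
    have "card (\<Union>i<Q n. vars (l n i)) \<le> card ({..<P n} \<union> (+) (P n) ` V n)"
      using l V by (intro card_mono) auto
    also have "\<dots> \<le> card {..<P n} + card ((+) (P n) ` V n)"
      by (rule card_Un_le)
    also have "\<dots> \<le> P n + length (C n)"
      using V by (simp add: card_image)
    finally show ?thesis .
  qed
  have "poly_bounded (\<lambda>n. card (\<Union>i<Q n. vars (l n i)))"
    by (rule poly_bounded_le[OF poly_bounded_add[OF Pb len] vars_le])
  \<comment> \<open>The bounds so far are in the index of \<open>g\<close>, which is evaluated at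
    \<open>q n\<close>.\<close>
  from poly_bounded_compose[OF this q]
  have vars_b: "poly_bounded (\<lambda>n. card (\<Union>i<Q (q n). vars (l (q n) i)))" .
  have "f n = (\<Sum>b\<in>bits (P (q n) + p n). \<Prod>i<Q (q n). plug (P (q n) + p n) b (l (q n) i))" for n
    by (simp add: f g_eq plug_sum plug_prod plug_plug sum_bits_add)
  then show ?thesis
    unfolding hypercube_product_family_def
    using poly_bounded_add[OF poly_bounded_compose[OF Pb q] p] poly_bounded_compose[OF Qb q] vars_b l
    by (intro exI[of _ "\<lambda>n. P (q n) + p n"] exI[of _ "\<lambda>n. Q (q n)"] exI[of _ "\<lambda>n. l (q n)"]) auto
qed

theorem theorem4p2:
  assumes "CHAR('a::field) \<noteq> 2"
  shows "(VNP1 :: 'a family set) = VNP \<and>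
    (\<forall>f :: 'a family. f \<in> VNP \<longleftrightarrow>
       (\<exists>p q. \<exists>l :: nat \<Rightarrow> nat \<Rightarrow> 'a mpoly.
          poly_bounded p \<and> poly_bounded q \<and>
          poly_bounded (\<lambda>n. card (\<Union>i<q n. vars (l n i))) \<and>
          (\<forall>n. \<forall>i<q n. affine_form (l n i)) \<and>
          (\<forall>n. f n = (\<Sum>b\<in>bits (p n). \<Prod>i<q n. plug (p n) b (l n i)))))"
proof -
  \<comment> \<open>Three inclusions form a cycle, from \<open>VNP1\<close> to \<open>VNP\<close>,
    on to the explicit representation and back. The assumption on the characteristic enters in the
    second.\<close>
  have "(VNP1 :: 'a family set) \<subseteq> VNP"
    unfolding VNP1_def VNP_def by (rule N_mono[OF VP1_subset_VP])
  moreover have "f \<in> VNP \<Longrightarrow> hypercube_product_family f" for f :: "'a family"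
    by (rule VNP_imp_hypercube_product_family[OF assms])
  moreover have "hypercube_product_family f \<Longrightarrow> f \<in> VNP1" for f :: "'a family"
    by (rule hypercube_product_family_in_VNP1)
  ultimately have "(VNP1 :: 'a family set) = VNP"
    and "\<forall>f :: 'a family. f \<in> VNP \<longleftrightarrow> hypercube_product_family f"
    by blast+
  then show ?thesis
    unfolding hypercube_product_family_def by blast
qed

end
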